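(* In the full information setting, there is a learning algorithm (Algorithm 1 of the paper: Hedge with the strategies of $\overline{\mathcal P}_{\le m}$ as experts, implemented through edge probabilities on a layered DAG via weight pushing) that uses $\mathrm{poly}(m,M)$ space and time per round and achieves $\mathsf{REG}\le O(M\sqrt{mT\log M})$.
   Context: A uniform price auction selling $K$ identical units is repeated over $T$ rounds ($T$ known). A bidder has a fixed valuation $1\ge v_1\ge\dots\ge v_M>0$ ($M\le K$), $w_j=\frac1j\sum_{\ell\le j}v_\ell$. An $m$-uniform strategy $\langle(b_1,q_1),\dots,(b_m,q_m)\rangle$ has $b_1>\dots>b_m>0$, positive integer $q_j$, $Q_j=\sum_{\ell\le j}q_\ell\le M$, and stands for the bid vector with $q_1$ copies of $b_1$, then $q_2$ copies of $b_2$, etc. Given competing bids $\boldsymbol\beta_-$ the $K$ highest bids win one unit each (ties in favor of the bidder), the allocation $x$ is the number of the bidder's winning bids, and $V(\mathbf b;\boldsymbol\beta_-)=\sum_{j\le x}v_j$. $\overline{\mathcal P}_{\le m}$ is the set of $k$-uniform strategies, $k\in[m]$, with $b_\ell=w_{Q_\ell}$ for all $\ell$. An oblivious adversary fixes competing bids $\boldsymbol\beta_-^1,\dots,\boldsymbol\beta_-^T$ in advance. In round $t$ the learner picks (possibly randomly) $\mathbf b^t\in\overline{\mathcal P}_{\le m}$ based on the past; under full information it observes all bids $\boldsymbol\beta_-^t$ after round $t$. Regret: $\mathsf{REG}=\max_{\mathbf b\in\overline{\mathcal P}_{\le m}}\sum_{t=1}^TV(\mathbf b;\boldsymbol\beta_-^t)-\sum_{t=1}^T\mathbb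 E[V(\mathbf b^t;\boldsymbol\beta_-^t)]$. *)

theory Defs
  imports "HOL-Probability.Probability" "HOL-Library.More_List"
begin

section \<open>The auction\<close>

text \<open>A valuation is the list \<open>[v_1, ..., v_M]\<close>, so list positions are shifted by one:
  \<open>v_j\<close> is \<open>v ! (j - 1)\<close>, and \<open>M = length v\<close>.\<close>

definition valuation :: "real list \<Rightarrow> bool" where
  "valuation v \<longleftrightarrow> v \<noteq> [] \<and> sorted_wrt (\<ge>) v \<and> (\<forall>x\<in>set v. 0 < x \<and> x \<le> 1)"

definition avg :: "real list \<Rightarrow> nat \<Rightarrow> real" where
  "avg v j = sum_list (take j v) / real j"

type_synonym strategy = "(real \<times> nat) list"

definition cum :: "strategy \<Rightarrow> nat \<Rightarrow> nat" where
  "cum s l = sum_list (map snd (take l s))"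

definition uniform_strategy :: "nat \<Rightarrow> nat \<Rightarrow> strategy \<Rightarrow> bool" where
  "uniform_strategy M k s \<longleftrightarrow>
     length s = k \<and> sorted_wrt (>) (map fst s) \<and>
     (\<forall>(b, q)\<in>set s. b > 0 \<and> q > 0) \<and> cum s k \<le> M"

definition bid_vector :: "strategy \<Rightarrow> real list" where
  "bid_vector s = concat (map (\<lambda>(b, q). replicate q b) s)"

definition strategies :: "real list \<Rightarrow> nat \<Rightarrow> strategy set" where
  "strategies v m =
     {s. \<exists>k\<in>{1..m}. uniform_strategy (length v) k s \<and>
           (\<forall>l\<in>{1..k}. fst (s ! (l - 1)) = avg v (cum s l))}"

text \<open>A bid wins if fewer than \<open>K\<close> bids are ranked above it.  A competing bid is ranked above
  a bid of the bidder only if it is strictly higher (ties go to the bidder); among the bidder's own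
  equal bids the earlier one is ranked first.\<close>

definition ranked_above :: "real list \<Rightarrow> real list \<Rightarrow> nat \<Rightarrow> nat" where
  "ranked_above b \<beta> j =
     card {i. i < length \<beta> \<and> \<beta> ! i > b ! j} +
     card {i. i < length b \<and> (b ! i > b ! j \<or> b ! i = b ! j \<and> i < j)}"

definition allocation :: "nat \<Rightarrow> real list \<Rightarrow> real list \<Rightarrow> nat" where
  "allocation K b \<beta> = card {j. j < length b \<and> ranked_above b \<beta> j < K}"

definition obtained_value :: "real list \<Rightarrow> nat \<Rightarrow> strategy \<Rightarrow> real list \<Rightarrow> real" where
  "obtained_value v K s \<beta> = sum_list (take (allocation K (bid_vector s) \<beta>) v)"

section \<open>Hedge over the strategies\<close>

text \<open>Rounds are numbered from 0; \<open>\<beta> t\<close> is the list of competing bids in round \<open>t\<close>.\<close>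

definition hedge_prob ::
    "real \<Rightarrow> real list \<Rightarrow> nat \<Rightarrow> nat \<Rightarrow> (nat \<Rightarrow> real list) \<Rightarrow> nat \<Rightarrow> strategy \<Rightarrow> real" where
  "hedge_prob \<eta> v m K \<beta> t s =
     exp (\<eta> * (\<Sum>\<tau><t. obtained_value v K s (\<beta> \<tau>))) /
     (\<Sum>a\<in>strategies v m. exp (\<eta> * (\<Sum>\<tau><t. obtained_value v K a (\<beta> \<tau>))))"

section \<open>The layered DAG and weight pushing\<close>

text \<open>A strategy with cumulative quantities \<open>Q_1 < ... < Q_k\<close> is the path
  \<open>Node 0 0, Node 1 Q_1, ..., Node k Q_k, Sink\<close>.  Since bids have to decrease strictly, an edge
  between two inner layers is present only if the corresponding averages do.\<close>

datatype node = Node nat nat | Sink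

fun edge :: "real list \<Rightarrow> nat \<Rightarrow> node \<Rightarrow> node \<Rightarrow> bool" where
  "edge v m (Node l z) (Node l' z') \<longleftrightarrow>
     l < m \<and> l' = l + 1 \<and> z < z' \<and> z' \<le> length v \<and>
     (if l = 0 then z = 0 else 1 \<le> z \<and> avg v z > avg v z')"
| "edge v m (Node l z) Sink \<longleftrightarrow> l \<in> {1..m} \<and> z \<in> {1..length v}"
| "edge v m Sink x \<longleftrightarrow> False"

definition path_of :: "strategy \<Rightarrow> node list" where
  "path_of s = Node 0 0 # map (\<lambda>l. Node l (cum s l)) [1..<length s + 1] @ [Sink]"

definition path_prob :: "(node \<Rightarrow> node \<Rightarrow> real) \<Rightarrow> node list \<Rightarrow> real" where
  "path_prob \<phi> p = (\<Prod>i<length p - 1. \<phi> (p ! i) (p ! (i + 1)))"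

text \<open>\<open>threshold K \<beta> j\<close> is the \<open>j\<close>-th lowest of the \<open>K\<close> highest competing bids, i.e. the
  \<open>(K - j + 1)\<close>-th highest one (0 if there are fewer), for \<open>1 \<le> j \<le> K\<close>.\<close>

definition threshold :: "nat \<Rightarrow> real list \<Rightarrow> nat \<Rightarrow> real" where
  "threshold K \<beta> j = nth_default 0 (rev (sort \<beta>)) (K - j)"

fun edge_weight :: "real list \<Rightarrow> nat \<Rightarrow> real list \<Rightarrow> node \<Rightarrow> node \<Rightarrow> real" where
  "edge_weight v K \<beta> (Node l z) (Node l' z') =
     (\<Sum>j\<in>{z+1..z'}. v ! (j - 1) * of_bool (avg v z' \<ge> threshold K \<beta> j))"
| "edge_weight v K \<beta> _ _ = 0"

function potential :: "real list \<Rightarrow> nat \<Rightarrow> (node \<Rightarrow> node \<Rightarrow> real) \<Rightarrow> node \<Rightarrow> real" where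
  "potential v m g Sink = 1"
| "potential v m g (Node l z) =
     (\<Sum>x | edge v m (Node l z) x. g (Node l z) x * potential v m g x)"
  by pat_completeness auto
termination
proof (relation "Wellfounded.measure (\<lambda>(v, m, g, u). case u of Sink \<Rightarrow> 0 | Node l z \<Rightarrow> Suc m - l)")
  fix v :: "real list" and m l z :: nat and g :: "node \<Rightarrow> node \<Rightarrow> real" and x
  assume "x \<in> {x. edge v m (Node l z) x}"
  then show "((v, m, g, x), (v, m, g, Node l z))
    \<in> Wellfounded.measure (\<lambda>(v, m, g, u). case u of Sink \<Rightarrow> 0 | Node l z \<Rightarrow> Suc m - l)"
    by (cases x) auto
qed simp

definition push_weights ::
    "real list \<Rightarrow> nat \<Rightarrow> (node \<Rightarrow> node \<Rightarrow> real) \<Rightarrow> node \<Rightarrow> node \<Rightarrow> real" where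
  "push_weights v m g u x = g u x * potential v m g x / potential v m g u"

text \<open>Pushing the constant weight 1 makes all source-sink paths equally likely, which is the
  uniform prior of Hedge.\<close>

primrec edge_prob ::
    "real \<Rightarrow> real list \<Rightarrow> nat \<Rightarrow> nat \<Rightarrow> (nat \<Rightarrow> real list) \<Rightarrow> nat \<Rightarrow> node \<Rightarrow> node \<Rightarrow> real" where
  "edge_prob \<eta> v m K \<beta> 0 = push_weights v m (\<lambda>_ _. 1)"
| "edge_prob \<eta> v m K \<beta> (Suc t) =
     push_weights v m
       (\<lambda>u x. edge_prob \<eta> v m K \<beta> t u x * exp (\<eta> * edge_weight v K (\<beta> t) u x))"

section \<open>The machine model: a randomized real RAM\<close>

text \<open>Programs of a unit-cost real RAM work on an array of integer cells (used for addressing) and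
  an array of real cells.  Index arithmetic is restricted to addition and truncated subtraction,
  and there is no conversion from reals to integers, in particular no floor.
  Loops are bounded, so that every program terminates.\<close>

datatype iexp =
    IConst nat
  | Par_m | Par_M | Par_K | Par_T
  | ILoad iexp
  | IPlus iexp iexp
  | IMinus iexp iexp

text \<open>\<open>Val i\<close> reads \<open>v_(i+1)\<close> and \<open>Bid i\<close> reads the \<open>(i+1)\<close>-th highest competing bid; both are
  read-only inputs.\<close>

datatype rexp =
    RNat iexp
  | RLoad iexp
  | Val iexp
  | Bid iexp
  | RPlus rexp rexp
  | RMinus rexp rexp
  | RTimes rexp rexp
  | RDiv rexp rexp
  | RExp rexp
  | RLn rexp
  | RSqrt rexp

datatype bexp =
    ILess iexp iexp
  | RLess rexp rexp
  | BNot bexp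
  | BAnd bexp bexp

text \<open>\<open>Flip p c1 c2\<close> executes \<open>c1\<close> with probability \<open>p\<close> and \<open>c2\<close> otherwise.
  \<open>For a n c\<close> evaluates \<open>n\<close> once and executes \<open>c\<close> with \<open>0, ..., n - 1\<close> in integer cell \<open>a\<close>.
  \<open>Emit b q\<close> appends the pair \<open>(b, q)\<close> to the submitted strategy, which cannot be read.\<close>

datatype com =
    Skip
  | IStore iexp iexp
  | RStore iexp rexp
  | Emit rexp iexp
  | Seq com com
  | If bexp com com
  | Flip rexp com com
  | For nat iexp com

record inputs =
  in_m :: nat
  in_K :: nat
  in_T :: nat
  in_vals :: "real list"
  in_bids :: "real list"

text \<open>The memory consists of as many cells as the lists are long: reading outside yields 0, and
  writing outside has no effect.  Thus the length of the lists is the space available.\<close>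

record state =
  imem :: "nat list"
  rmem :: "real list"
  out :: strategy
  steps :: nat

primrec ival :: "iexp \<Rightarrow> inputs \<Rightarrow> state \<Rightarrow> nat" where
  "ival (IConst n) I s = n"
| "ival Par_m I s = in_m I"
| "ival Par_M I s = length (in_vals I)"
| "ival Par_K I s = in_K I"
| "ival Par_T I s = in_T I"
| "ival (ILoad e) I s = nth_default 0 (imem s) (ival e I s)"
| "ival (IPlus e f) I s = ival e I s + ival f I s"
| "ival (IMinus e f) I s = ival e I s - ival f I s"

primrec rval :: "rexp \<Rightarrow> inputs \<Rightarrow> state \<Rightarrow> real" where
  "rval (RNat e) I s = real (ival e I s)"
| "rval (RLoad e) I s = nth_default 0 (rmem s) (ival e I s)"
| "rval (Val e) I s = nth_default 0 (in_vals I) (ival e I s)"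
| "rval (Bid e) I s = nth_default 0 (rev (sort (in_bids I))) (ival e I s)"
| "rval (RPlus e f) I s = rval e I s + rval f I s"
| "rval (RMinus e f) I s = rval e I s - rval f I s"
| "rval (RTimes e f) I s = rval e I s * rval f I s"
| "rval (RDiv e f) I s = rval e I s / rval f I s"
| "rval (RExp e) I s = exp (rval e I s)"
| "rval (RLn e) I s = ln (rval e I s)"
| "rval (RSqrt e) I s = sqrt (rval e I s)"

primrec bval :: "bexp \<Rightarrow> inputs \<Rightarrow> state \<Rightarrow> bool" where
  "bval (ILess e f) I s \<longleftrightarrow> ival e I s < ival f I s"
| "bval (RLess e f) I s \<longleftrightarrow> rval e I s < rval f I s"
| "bval (BNot b) I s \<longleftrightarrow> \<not> bval b I s"
| "bval (BAnd b c) I s \<longleftrightarrow> bval b I s \<and> bval c I s"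

text \<open>Evaluating an expression takes one step per operation, constant or input access.\<close>

primrec icost :: "iexp \<Rightarrow> nat" where
  "icost (IConst n) = 1"
| "icost Par_m = 1"
| "icost Par_M = 1"
| "icost Par_K = 1"
| "icost Par_T = 1"
| "icost (ILoad e) = 1 + icost e"
| "icost (IPlus e f) = 1 + icost e + icost f"
| "icost (IMinus e f) = 1 + icost e + icost f"

primrec rcost :: "rexp \<Rightarrow> nat" where
  "rcost (RNat e) = 1 + icost e"
| "rcost (RLoad e) = 1 + icost e"
| "rcost (Val e) = 1 + icost e"
| "rcost (Bid e) = 1 + icost e"
| "rcost (RPlus e f) = 1 + rcost e + rcost f"
| "rcost (RMinus e f) = 1 + rcost e + rcost f"
| "rcost (RTimes e f) = 1 + rcost e + rcost f"
| "rcost (RDiv e f) = 1 + rcost e + rcost f"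
| "rcost (RExp e) = 1 + rcost e"
| "rcost (RLn e) = 1 + rcost e"
| "rcost (RSqrt e) = 1 + rcost e"

primrec bcost :: "bexp \<Rightarrow> nat" where
  "bcost (ILess e f) = 1 + icost e + icost f"
| "bcost (RLess e f) = 1 + rcost e + rcost f"
| "bcost (BNot b) = 1 + bcost b"
| "bcost (BAnd b c) = 1 + bcost b + bcost c"

definition tick :: "nat \<Rightarrow> state \<Rightarrow> state" where
  "tick n s = s\<lparr>steps := steps s + n\<rparr>"

primrec iterate :: "(nat \<Rightarrow> 'a \<Rightarrow> 'a pmf) \<Rightarrow> nat \<Rightarrow> 'a \<Rightarrow> 'a pmf" where
  "iterate f 0 s = return_pmf s"
| "iterate f (Suc n) s = bind_pmf (iterate f n s) (f n)"

primrec exec :: "com \<Rightarrow> inputs \<Rightarrow> state \<Rightarrow> state pmf" where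
  "exec Skip I s = return_pmf (tick 1 s)"
| "exec (IStore a e) I s =
     return_pmf (tick (1 + icost a + icost e)
       (s\<lparr>imem := (imem s)[ival a I s := ival e I s]\<rparr>))"
| "exec (RStore a e) I s =
     return_pmf (tick (1 + icost a + rcost e)
       (s\<lparr>rmem := (rmem s)[ival a I s := rval e I s]\<rparr>))"
| "exec (Emit e f) I s =
     return_pmf (tick (1 + rcost e + icost f)
       (s\<lparr>out := out s @ [(rval e I s, ival f I s)]\<rparr>))"
| "exec (Seq c d) I s = bind_pmf (exec c I s) (exec d I)"
| "exec (If b c d) I s =
     (if bval b I s then exec c I (tick (1 + bcost b) s)
      else exec d I (tick (1 + bcost b) s))"
| "exec (Flip p c d) I s =
     bind_pmf (bernoulli_pmf (rval p I s))
       (\<lambda>h. if h then exec c I (tick (1 + rcost p) s)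
             else exec d I (tick (1 + rcost p) s))"
| "exec (For a n c) I s =
     iterate (\<lambda>i s. exec c I (tick 1 (s\<lparr>imem := (imem s)[a := i]\<rparr>)))
       (ival n I s) (tick (1 + icost n) s)"

section \<open>Playing the repeated auction\<close>

text \<open>The program \<open>bid_com\<close> emits the strategy of the round and sees no competing bids;
  \<open>learn_com\<close> then sees all competing bids of that round, but what it emits is ignored.
  Everything else has to be remembered in the memory.\<close>

record learner =
  init_com :: com
  bid_com :: com
  learn_com :: com

definition start_round :: "state \<Rightarrow> state" where
  "start_round s = s\<lparr>out := [], steps := 0\<rparr>"

definition choice ::
    "learner \<Rightarrow> nat \<Rightarrow> nat \<Rightarrow> nat \<Rightarrow> real list \<Rightarrow> state \<Rightarrow> state pmf" where
  "choice A m K T v s =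
     exec (bid_com A) \<lparr>in_m = m, in_K = K, in_T = T, in_vals = v, in_bids = []\<rparr> (start_round s)"

text \<open>\<open>after_rounds A S m K T v \<beta> t\<close> is the distribution of the state after \<open>t\<close> rounds on a machine
  with \<open>S\<close> integer and \<open>S\<close> real cells.  Its step counter covers the last round only, or the
  initialization if \<open>t = 0\<close>.\<close>

primrec after_rounds ::
    "learner \<Rightarrow> nat \<Rightarrow> nat \<Rightarrow> nat \<Rightarrow> nat \<Rightarrow> real list \<Rightarrow> (nat \<Rightarrow> real list) \<Rightarrow> nat \<Rightarrow> state pmf" where
  "after_rounds A S m K T v \<beta> 0 =
     exec (init_com A) \<lparr>in_m = m, in_K = K, in_T = T, in_vals = v, in_bids = []\<rparr>
       \<lparr>imem = replicate S 0, rmem = replicate S 0, out = [], steps = 0\<rparr>"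
| "after_rounds A S m K T v \<beta> (Suc t) =
     bind_pmf (after_rounds A S m K T v \<beta> t) (\<lambda>s.
     bind_pmf (choice A m K T v s)
       (exec (learn_com A) \<lparr>in_m = m, in_K = K, in_T = T, in_vals = v, in_bids = \<beta> t\<rparr>))"

definition submitted ::
    "learner \<Rightarrow> nat \<Rightarrow> nat \<Rightarrow> nat \<Rightarrow> nat \<Rightarrow> real list \<Rightarrow> (nat \<Rightarrow> real list) \<Rightarrow> nat \<Rightarrow> strategy pmf" where
  "submitted A S m K T v \<beta> t =
     bind_pmf (after_rounds A S m K T v \<beta> t) (\<lambda>s. map_pmf out (choice A m K T v s))"

definition regret ::
    "learner \<Rightarrow> nat \<Rightarrow> nat \<Rightarrow> nat \<Rightarrow> nat \<Rightarrow> real list \<Rightarrow> (nat \<Rightarrow> real list) \<Rightarrow> real" where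
  "regret A S m K T v \<beta> =
     Max ((\<lambda>b. \<Sum>t<T. obtained_value v K b (\<beta> t)) ` strategies v m) -
     (\<Sum>t<T. measure_pmf.expectation (submitted A S m K T v \<beta> t)
               (\<lambda>b. obtained_value v K b (\<beta> t)))"

text \<open>The learner is Hedge implemented by weight pushing: between rounds its real memory holds the
  edge probabilities of the DAG (at addresses that depend on \<open>m\<close> and \<open>M\<close> only), and, whatever
  happened before, the next strategy is drawn as a path according to these edge probabilities, which
  amounts to the Hedge distribution on the strategies.\<close>

definition weight_pushing_hedge ::
    "learner \<Rightarrow> (nat \<Rightarrow> nat \<Rightarrow> node \<Rightarrow> node \<Rightarrow> nat) \<Rightarrow> real \<Rightarrow> nat \<Rightarrow> nat \<Rightarrow> nat \<Rightarrow> nat \<Rightarrow>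
      real list \<Rightarrow> (nat \<Rightarrow> real list) \<Rightarrow> bool" where
  "weight_pushing_hedge A addr \<eta> S m K T v \<beta> \<longleftrightarrow>
     (\<forall>t<T. \<forall>s\<in>set_pmf (after_rounds A S m K T v \<beta> t).
        (\<forall>u x. edge v m u x \<longrightarrow>
           nth_default 0 (rmem s) (addr m (length v) u x) = edge_prob \<eta> v m K \<beta> t u x) \<and>
        out ` set_pmf (choice A m K T v s) \<subseteq> strategies v m \<and>
        (\<forall>b\<in>strategies v m.
           pmf (map_pmf out (choice A m K T v s)) b =
             path_prob (edge_prob \<eta> v m K \<beta> t) (path_of b) \<and>
           path_prob (edge_prob \<eta> v m K \<beta> t) (path_of b) = hedge_prob \<eta> v m K \<beta> t b))"

end

(* Bids are sorted and ties favour the bidder, so the j-th bid wins iff it reaches the j-th threshold;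
   the value of a strategy is therefore the weight of its path, and the product of the exponential
   edge weights along a path is its Hedge weight.  Weight pushing multiplies the probability of an
   edge by a ratio of potentials, which telescopes along a path and only changes the normalization.
   That the path probabilities sum to 1 is read off the sampler, whose output is a strategy with
   probability 1.  For the sampler, the expected value of a function of the submitted strategy is a
   martingale along the execution of the program; all other parts of the program are deterministic and
   handled by invariants.  With gains in [0, M] and at most (M + 1)^m experts, Hedge with rate
   sqrt (m ln (M + 1) / T) / M has regret O(M sqrt (m T ln M)). *)

theory Submission
  imports Defs
begin

text \<open>Paths have between 2 and m + 1 edges, whereas a program loop has a number of rounds
  fixed on entry. Making the sink absorbing gives every walk exactly m + 1 steps and turns the edge
  probabilities into a full rectangular array with zeros at non-edges, so that the same arithmetic,
  without any case distinction, serves edges, non-edges and the self-loop. Reading the total mass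
  off the sampler spares a bijection between source-sink paths and strategies: only the path of a
  given strategy is ever followed. All distributions have finite support, since chance enters
  through coin flips in bounded loops. Two calculi suffice: \<open>wlp\<close> for what holds on the
  whole support and \<open>wpe\<close> for expectations; the first supplies the invariants under
  which the second is evaluated. The regret bound has ln M, which vanishes for M = 1, while the rate
  has to be positive. Hence the ln (M + 1) in the rate, and the separate treatment of M = 1, where
  only one strategy exists.\<close>

section \<open>Expectations and iteration of finitely supported distributions\<close>

abbreviation expect :: "'a pmf \<Rightarrow> ('a \<Rightarrow> real) \<Rightarrow> real" where
  "expect \<equiv> measure_pmf.expectation"

lemma expect_cong:
  assumes "\<And>x. x \<in> set_pmf p \<Longrightarrow> f x = g x"
  shows "expect p f = expect p g"
  using assms by (intro integral_cong_AE) (auto simp: AE_measure_pmf_iff)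

lemma expect_bind:
  fixes h :: "'b \<Rightarrow> real"
  assumes "finite (set_pmf p)" "\<And>x. x \<in> set_pmf p \<Longrightarrow> finite (set_pmf (f x))"
  shows "expect (bind_pmf p f) h = expect p (\<lambda>x. expect (f x) h)"
proof -
  have "expect (bind_pmf p f) h = (\<Sum>x\<in>set_pmf p. pmf p x * expect (f x) h)"
    using assms by (subst pmf_expectation_bind[where A = "set_pmf p"]) auto
  also have "\<dots> = expect p (\<lambda>x. expect (f x) h)"
    using assms(1) by (subst integral_measure_pmf_real[where A = "set_pmf p"]) (auto simp: mult.commute)
  finally show ?thesis .
qed

lemma finite_iterate:
  assumes "\<And>i s. finite (set_pmf (f i s))"
  shows "finite (set_pmf (iterate f n s))"
  using assms by (induction n) auto

lemma iterate_invariant: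
  assumes "P 0 s"
    and "\<And>i s s'. i < n \<Longrightarrow> P i s \<Longrightarrow> s' \<in> set_pmf (f i s) \<Longrightarrow> P (Suc i) s'"
  shows "\<forall>s'\<in>set_pmf (iterate f n s). P n s'"
  using assms(2)
proof (induction n)
  case 0
  then show ?case using assms(1) by simp
next
  case (Suc n)
  then show ?case by auto
qed

text \<open>\<open>\<Phi>\<close> is a martingale of the iteration. The one-step identity is usually
  false on arbitrary states, so it is demanded only under an invariant \<open>P\<close> that is
  carried along.\<close>

lemma iterate_expect:
  assumes "P 0 s"
    and "\<And>i s s'. i < n \<Longrightarrow> P i s \<Longrightarrow> s' \<in> set_pmf (f i s) \<Longrightarrow> P (Suc i) s'"
    and "\<And>i s. i < n \<Longrightarrow> P i s \<Longrightarrow> expect (f i s) (\<Phi> (Suc i)) = \<Phi> i s"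
    and "\<And>i s. finite (set_pmf (f i s))"
  shows "expect (iterate f n s) (\<Phi> n) = \<Phi> 0 s"
  using assms(2,3)
proof (induction n)
  case 0
  then show ?case by simp
next
  case (Suc n)
  have "expect (iterate f (Suc n) s) (\<Phi> (Suc n)) = expect (iterate f n s) (\<lambda>s. expect (f n s) (\<Phi> (Suc n)))"
    by (simp add: expect_bind finite_iterate assms(4))
  also have "\<dots> = expect (iterate f n s) (\<Phi> n)"
    using iterate_invariant[of P s n f] Suc.prems assms(1) by (intro expect_cong) auto
  also have "\<dots> = \<Phi> 0 s"
    using Suc by auto
  finally show ?case .
qed

section \<open>Executing programs\<close>

definition iset :: "nat \<Rightarrow> nat \<Rightarrow> state \<Rightarrow> state" where
  "iset a x s = s\<lparr>imem := (imem s)[a := x]\<rparr>"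

definition rset :: "nat \<Rightarrow> real \<Rightarrow> state \<Rightarrow> state" where
  "rset a x s = s\<lparr>rmem := (rmem s)[a := x]\<rparr>"

definition emit :: "real \<times> nat \<Rightarrow> state \<Rightarrow> state" where
  "emit p s = s\<lparr>out := out s @ [p]\<rparr>"

definition icell :: "state \<Rightarrow> nat \<Rightarrow> nat" where
  "icell s = nth_default 0 (imem s)"

lemma finite_exec: "finite (set_pmf (exec c I s))"
proof (induction c arbitrary: s)
  case (For a n c)
  then show ?case by (auto intro!: finite_iterate)
qed auto

text \<open>Almost sure postcondition. Every program terminates, so partial and total correctness
  coincide.\<close>

definition wlp :: "inputs \<Rightarrow> com \<Rightarrow> (state \<Rightarrow> bool) \<Rightarrow> state \<Rightarrow> bool" where
  "wlp I c Q s \<longleftrightarrow> (\<forall>s'\<in>set_pmf (exec c I s). Q s')"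

lemma wlp_Skip: "wlp I Skip Q s = Q (tick 1 s)"
  by (simp add: wlp_def)

lemma wlp_IStore:
  "wlp I (IStore a e) Q s = Q (tick (1 + icost a + icost e) (iset (ival a I s) (ival e I s) s))"
  by (simp add: wlp_def iset_def)

lemma wlp_RStore:
  "wlp I (RStore a e) Q s = Q (tick (1 + icost a + rcost e) (rset (ival a I s) (rval e I s) s))"
  by (simp add: wlp_def rset_def)

lemma wlp_Emit:
  "wlp I (Emit e f) Q s = Q (tick (1 + rcost e + icost f) (emit (rval e I s, ival f I s) s))"
  by (simp add: wlp_def emit_def)

lemma wlp_Seq: "wlp I (Seq c d) Q s = wlp I c (wlp I d Q) s"
  by (simp add: wlp_def)

lemma wlp_If:
  "wlp I (If b c d) Q s =
     (if bval b I s then wlp I c Q (tick (1 + bcost b) s) else wlp I d Q (tick (1 + bcost b) s))"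
  by (simp add: wlp_def)

text \<open>Only an implication: with a bias of 0 or 1 one branch is never taken. In return nothing
  has to be known about the bias.\<close>

lemma wlp_Flip:
  assumes "wlp I c Q (tick (1 + rcost p) s)" "wlp I d Q (tick (1 + rcost p) s)"
  shows "wlp I (Flip p c d) Q s"
  using assms by (auto simp: wlp_def split: if_splits)

lemma wlp_For:
  assumes "P 0 (tick (1 + icost e) s)"
    and "\<And>i s'. i < ival e I s \<Longrightarrow> P i s' \<Longrightarrow> wlp I c (P (Suc i)) (tick 1 (iset a i s'))"
    and "\<And>s'. P (ival e I s) s' \<Longrightarrow> Q s'"
  shows "wlp I (For a e c) Q s"
proof -
  have "\<forall>s'\<in>set_pmf (exec (For a e c) I s). P (ival e I s) s'"
    unfolding exec.simps using assms(1,2)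
    by (intro iterate_invariant) (auto simp: wlp_def iset_def)
  then show ?thesis using assms(3) by (auto simp: wlp_def)
qed

lemma wlp_mono:
  assumes "wlp I c P s" "\<And>s'. P s' \<Longrightarrow> Q s'"
  shows "wlp I c Q s"
  using assms by (auto simp: wlp_def)

lemmas wlp_simps = wlp_Skip wlp_IStore wlp_RStore wlp_Emit wlp_Seq wlp_If

text \<open>The weakest pre-expectation of probabilistic program logic, the quantitative counterpart
  of \<open>wlp\<close>.\<close>

definition wpe :: "inputs \<Rightarrow> com \<Rightarrow> (state \<Rightarrow> real) \<Rightarrow> state \<Rightarrow> real" where
  "wpe I c F s = expect (exec c I s) F"

lemma wpe_Skip: "wpe I Skip F s = F (tick 1 s)"
  by (simp add: wpe_def)

lemma wpe_IStore:
  "wpe I (IStore a e) F s = F (tick (1 + icost a + icost e) (iset (ival a I s) (ival e I s) s))"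
  by (simp add: wpe_def iset_def)

lemma wpe_RStore:
  "wpe I (RStore a e) F s = F (tick (1 + icost a + rcost e) (rset (ival a I s) (rval e I s) s))"
  by (simp add: wpe_def rset_def)

lemma wpe_Emit:
  "wpe I (Emit e f) F s = F (tick (1 + rcost e + icost f) (emit (rval e I s, ival f I s) s))"
  by (simp add: wpe_def emit_def)

lemma wpe_Seq: "wpe I (Seq c d) F s = wpe I c (wpe I d F) s"
  by (simp add: wpe_def [abs_def] expect_bind finite_exec)

lemma wpe_If:
  "wpe I (If b c d) F s =
     (if bval b I s then wpe I c F (tick (1 + bcost b) s) else wpe I d F (tick (1 + bcost b) s))"
  by (simp add: wpe_def)

text \<open>The range of the bias matters here, because \<open>bernoulli_pmf\<close> clips its
  argument to the unit interval.\<close>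

lemma wpe_Flip:
  assumes "0 \<le> rval p I s" "rval p I s \<le> 1"
  shows "wpe I (Flip p c d) F s =
    rval p I s * wpe I c F (tick (1 + rcost p) s) + (1 - rval p I s) * wpe I d F (tick (1 + rcost p) s)"
  using assms by (simp add: wpe_def expect_bind finite_exec)

text \<open>Couples the calculi: a post-expectation may be simplified under any postcondition
  established by \<open>wlp\<close>.\<close>

lemma wpe_cong:
  assumes "wlp I c P s" "\<And>s'. P s' \<Longrightarrow> F s' = G s'"
  shows "wpe I c F s = wpe I c G s"
  using assms by (auto simp: wlp_def wpe_def intro!: expect_cong)

lemma wpe_For:
  assumes "P 0 (tick (1 + icost e) s)"
    and "\<And>i s'. i < ival e I s \<Longrightarrow> P i s' \<Longrightarrow> wlp I c (P (Suc i)) (tick 1 (iset a i s'))"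
    and "\<And>i s'. i < ival e I s \<Longrightarrow> P i s' \<Longrightarrow> wpe I c (\<Phi> (Suc i)) (tick 1 (iset a i s')) = \<Phi> i s'"
  shows "wpe I (For a e c) (\<Phi> (ival e I s)) s = \<Phi> 0 (tick (1 + icost e) s)"
  unfolding wpe_def exec.simps
  by (rule iterate_expect[where P = P])
    (use assms in \<open>auto simp: wlp_def wpe_def iset_def finite_exec\<close>)

lemmas wpe_simps = wpe_Skip wpe_IStore wpe_RStore wpe_Emit wpe_Seq wpe_If

section \<open>Running time of programs with bounded loops\<close>

text \<open>The bound is required in all states; this is met by loop counts that depend on the input
  parameters only.\<close>

primrec loop_bounded :: "inputs \<Rightarrow> nat \<Rightarrow> com \<Rightarrow> bool" where
  "loop_bounded I B Skip \<longleftrightarrow> True"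
| "loop_bounded I B (IStore a e) \<longleftrightarrow> True"
| "loop_bounded I B (RStore a e) \<longleftrightarrow> True"
| "loop_bounded I B (Emit e f) \<longleftrightarrow> True"
| "loop_bounded I B (Seq c d) \<longleftrightarrow> loop_bounded I B c \<and> loop_bounded I B d"
| "loop_bounded I B (If b c d) \<longleftrightarrow> loop_bounded I B c \<and> loop_bounded I B d"
| "loop_bounded I B (Flip p c d) \<longleftrightarrow> loop_bounded I B c \<and> loop_bounded I B d"
| "loop_bounded I B (For a n c) \<longleftrightarrow> (\<forall>s. ival n I s \<le> B) \<and> loop_bounded I B c"

text \<open>An upper bound for the loop depth: the depths of successive parts are added instead of
  maximized, so that exponents simply add up and no maximum has to be handled.\<close>

primrec nesting :: "com \<Rightarrow> nat" where
  "nesting Skip = 0"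
| "nesting (IStore a e) = 0"
| "nesting (RStore a e) = 0"
| "nesting (Emit e f) = 0"
| "nesting (Seq c d) = nesting c + nesting d"
| "nesting (If b c d) = nesting c + nesting d"
| "nesting (Flip p c d) = nesting c + nesting d"
| "nesting (For a n c) = Suc (nesting c)"

primrec weight :: "com \<Rightarrow> nat" where
  "weight Skip = 1"
| "weight (IStore a e) = 1 + icost a + icost e"
| "weight (RStore a e) = 1 + icost a + rcost e"
| "weight (Emit e f) = 1 + rcost e + icost f"
| "weight (Seq c d) = weight c + weight d"
| "weight (If b c d) = 1 + bcost b + weight c + weight d"
| "weight (Flip p c d) = 1 + rcost p + weight c + weight d"
| "weight (For a n c) = 2 + icost n + weight c"

lemma weighted_power_add_le:
  fixes B :: nat
  assumes "1 \<le> B"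
  shows "k + x * B ^ i + y * B ^ j \<le> (k + x + y) * B ^ (i + j)"
proof -
  have "k * 1 \<le> k * B ^ (i + j)" "x * B ^ i \<le> x * B ^ (i + j)" "y * B ^ j \<le> y * B ^ (i + j)"
    using assms by (intro mult_le_mono2; simp add: power_increasing)+
  then show ?thesis unfolding add_mult_distrib mult_1_right mult_1_left by linarith
qed

text \<open>A loop of at most \<open>B\<close> rounds multiplies the cost of its body by
  \<open>B\<close>, plus one step per round for the counter; induction then gives a polynomial in
  \<open>B\<close> whose degree and coefficient are read off the syntax.\<close>

lemma steps_exec_le:
  assumes "1 \<le> B" "loop_bounded I B c" "s' \<in> set_pmf (exec c I s)"
  shows "steps s' \<le> steps s + weight c * B ^ nesting c"
  using assms(2,3)
proof (induction c arbitrary: s s')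
  case (Seq c d)
  from Seq.prems obtain s1 where s1: "s1 \<in> set_pmf (exec c I s)" "s' \<in> set_pmf (exec d I s1)"
    by auto
  have "steps s' \<le> steps s1 + weight d * B ^ nesting d"
    "steps s1 \<le> steps s + weight c * B ^ nesting c"
    using Seq s1 by auto
  then show ?case
    using weighted_power_add_le[OF assms(1), of 0 "weight c" "nesting c" "weight d" "nesting d"] by simp
next
  case (If b c d)
  have "steps s' \<le> steps s + (1 + bcost b) + weight c * B ^ nesting c + weight d * B ^ nesting d"
  proof (cases "bval b I s")
    case True
    then have "steps s' \<le> steps (tick (1 + bcost b) s) + weight c * B ^ nesting c"
      using If by (intro If.IH(1)) auto
    then show ?thesis by (simp add: tick_def)
  next
    case False
    then have "steps s' \<le> steps (tick (1 + bcost b) s) + weight d * B ^ nesting d"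
      using If by (intro If.IH(2)) auto
    then show ?thesis by (simp add: tick_def)
  qed
  then show ?case
    using weighted_power_add_le[OF assms(1), of "1 + bcost b" "weight c" "nesting c" "weight d" "nesting d"]
    by simp
next
  case (Flip p c d)
  have "s' \<in> set_pmf (exec c I (tick (1 + rcost p) s)) \<or> s' \<in> set_pmf (exec d I (tick (1 + rcost p) s))"
    using Flip.prems by (auto split: if_splits)
  then have "steps s' \<le> steps s + (1 + rcost p) + weight c * B ^ nesting c + weight d * B ^ nesting d"
  proof
    assume "s' \<in> set_pmf (exec c I (tick (1 + rcost p) s))"
    then have "steps s' \<le> steps (tick (1 + rcost p) s) + weight c * B ^ nesting c"
      using Flip by (intro Flip.IH(1)) auto
    then show ?thesis by (simp add: tick_def)
  next
    assume "s' \<in> set_pmf (exec d I (tick (1 + rcost p) s))"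
    then have "steps s' \<le> steps (tick (1 + rcost p) s) + weight d * B ^ nesting d"
      using Flip by (intro Flip.IH(2)) auto
    then show ?thesis by (simp add: tick_def)
  qed
  then show ?case
    using weighted_power_add_le[OF assms(1), of "1 + rcost p" "weight c" "nesting c" "weight d" "nesting d"]
    by simp
next
  case (For a n c)
  let ?w = "weight c * B ^ nesting c"
  have "\<forall>s'\<in>set_pmf (exec (For a n c) I s).
      steps s' \<le> steps s + (1 + icost n) + ival n I s * (1 + ?w)"
    unfolding exec.simps
  proof (rule iterate_invariant[where P = "\<lambda>i s'. steps s' \<le> steps s + (1 + icost n) + i * (1 + ?w)"])
    fix i s1 s2
    assume s1: "steps s1 \<le> steps s + (1 + icost n) + i * (1 + ?w)"
      and s2: "s2 \<in> set_pmf (exec c I (tick 1 (s1\<lparr>imem := (imem s1)[a := i]\<rparr>)))"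
    have "steps s2 \<le> steps (tick 1 (s1\<lparr>imem := (imem s1)[a := i]\<rparr>)) + ?w"
      using For.prems s2 by (intro For.IH) auto
    then show "steps s2 \<le> steps s + (1 + icost n) + Suc i * (1 + ?w)"
      using s1 by (simp add: tick_def)
  qed (simp add: tick_def)
  moreover have "ival n I s * (1 + ?w) \<le> B * (1 + ?w)"
    using For.prems by (intro mult_le_mono1) auto
  moreover have "1 + icost n + B * (1 + ?w) \<le> weight (For a n c) * B ^ nesting (For a n c)"
  proof -
    have "1 + icost n + 1 * B ^ 1 + weight c * B ^ (1 + nesting c)
        \<le> (1 + icost n + 1 + weight c) * B ^ (1 + nesting c)"
    proof -
      have "(1 + icost n) * 1 \<le> (1 + icost n) * B ^ (1 + nesting c)" "B ^ 1 \<le> B ^ (1 + nesting c)"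
        using assms(1) by (intro mult_le_mono2 one_le_power power_increasing; simp)+
      then show ?thesis unfolding add_mult_distrib mult_1_right mult_1_left by linarith
    qed
    then show ?thesis by (simp add: algebra_simps)
  qed
  ultimately show ?case using For.prems by fastforce
qed (auto simp: tick_def)

section \<open>The value of a strategy as the weight of its path\<close>

lemma cum_0: "cum s 0 = 0"
  by (simp add: cum_def)

lemma cum_Suc: "l < length s \<Longrightarrow> cum s (Suc l) = cum s l + snd (s ! l)"
  by (simp add: cum_def take_Suc_conv_app_nth)

lemma cum_mono: "l \<le> l' \<Longrightarrow> cum s l \<le> cum s l'"
  by (metis cum_def le_add1 le_add_diff_inverse map_append sum_list_append take_add)

lemma cum_append: "l \<le> length s \<Longrightarrow> cum (s @ s') l = cum s l"
  by (simp add: cum_def)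

lemma bid_vector_simps [simp]:
  "bid_vector [] = []" "bid_vector (p # s) = replicate (snd p) (fst p) @ bid_vector s"
  by (auto simp: bid_vector_def split: prod.splits)

lemma length_bid_vector: "length (bid_vector s) = cum s (length s)"
  by (induction s) (auto simp: cum_def)

lemma set_bid_vector: "set (bid_vector s) \<subseteq> fst ` set s"
  by (induction s) auto

lemma sorted_bid_vector:
  "sorted_wrt (>) (map fst s) \<Longrightarrow> sorted_wrt (\<ge>) (bid_vector s)"
proof (induction s)
  case (Cons p s)
  have "sorted_wrt (\<ge>) (replicate n x)" for n and x :: real
    by (simp add: sorted_wrt_iff_nth_less)
  moreover have "y \<le> fst p" if "y \<in> set (bid_vector s)" for y
    using that Cons.prems set_bid_vector[of s] by fastforce
  ultimately show ?case
    using Cons by (simp add: sorted_wrt_append)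
qed simp

lemma nth_bid_vector:
  assumes "l < length s" "cum s l \<le> j" "j < cum s (Suc l)"
  shows "bid_vector s ! j = fst (s ! l)"
  using assms
proof (induction s arbitrary: l j)
  case (Cons p s)
  show ?case
  proof (cases l)
    case 0
    then show ?thesis using Cons.prems by (simp add: cum_def nth_append)
  next
    case (Suc l')
    then have "cum s l' \<le> j - snd p" "j - snd p < cum s (Suc l')" "snd p \<le> j" "l' < length s"
      using Cons.prems by (auto simp: cum_def)
    then show ?thesis using Cons.IH[of l' "j - snd p"] Suc by (simp add: nth_append)
  qed
qed simp

section \<open>Thresholds and winning bids\<close>

text \<open>In a descending list, at most \<open>n\<close> entries exceed \<open>x\<close> iff the
  entry at index \<open>n\<close> does not. If that entry is missing, the left side is true, and the
  default 0 agrees because \<open>0 \<le> x\<close>.\<close>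

lemma count_above_le_iff:
  fixes d :: "real list"
  assumes "sorted_wrt (\<ge>) d" "0 \<le> x"
  shows "length (filter (\<lambda>y. x < y) d) \<le> n \<longleftrightarrow> nth_default 0 d n \<le> x"
  using assms
proof (induction d arbitrary: n)
  case (Cons y d)
  show ?case
  proof (cases "x < y")
    case True
    then show ?thesis using Cons by (cases n) auto
  next
    case False
    then have "filter (\<lambda>y. x < y) d = []"
      using Cons.prems by (auto simp: filter_empty_conv)
    moreover have "nth_default 0 d k \<le> x" for k
      using Cons.IH[of k] Cons.prems calculation by auto
    ultimately show ?thesis using False by (cases n) auto
  qed
qed (simp add: nth_default_def)

text \<open>By sortedness and the tie rule exactly the \<open>j\<close> earlier own bids precede bid
  \<open>j\<close>. So it wins iff at most \<open>K - Suc j\<close> competing bids exceed it, and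
  that number is the index used by \<open>threshold K \<beta> (Suc j)\<close>.\<close>

lemma ranked_above_less_iff:
  assumes "sorted_wrt (\<ge>) b" "j < length b" "j < K" "0 \<le> b ! j"
  shows "ranked_above b \<beta> j < K \<longleftrightarrow> threshold K \<beta> (Suc j) \<le> b ! j"
proof -
  have "{i. i < length b \<and> (b ! i > b ! j \<or> b ! i = b ! j \<and> i < j)} = {..<j}"
  proof (rule set_eqI)
    fix i
    have "j < i \<longrightarrow> i < length b \<longrightarrow> b ! i \<le> b ! j"
      using assms(1) by (simp add: sorted_wrt_iff_nth_less)
    moreover have "i < j \<longrightarrow> b ! j \<le> b ! i"
      using assms(1,2) by (simp add: sorted_wrt_iff_nth_less)
    ultimately show "i \<in> {i. i < length b \<and> (b ! i > b ! j \<or> b ! i = b ! j \<and> i < j)} \<longleftrightarrow> i \<in> {..<j}"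
      using assms(2) by (cases i j rule: linorder_cases) (auto simp: not_less)
  qed
  then have "ranked_above b \<beta> j = length (filter (\<lambda>y. b ! j < y) \<beta>) + j"
    by (simp add: ranked_above_def length_filter_conv_card)
  moreover have "length (filter (\<lambda>y. b ! j < y) \<beta>) = length (filter (\<lambda>y. b ! j < y) (rev (sort \<beta>)))"
    by (simp add: rev_filter[symmetric] filter_sort)
  moreover have "sorted_wrt (\<ge>) (rev (sort \<beta>))"
    by (simp add: sorted_wrt_rev)
  ultimately show ?thesis
    using count_above_le_iff[of "rev (sort \<beta>)" "b ! j" "K - Suc j"] assms
    by (auto simp: threshold_def)
qed

text \<open>Ranks do not decrease along a sorted bid vector, so the winning positions are closed
  downwards; an initial segment is determined by its cardinality.\<close>

lemma winning_bids_eq: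
  fixes b :: "real list"
  assumes "sorted_wrt (\<ge>) b"
  shows "{j. j < length b \<and> ranked_above b \<beta> j < K} = {..<allocation K b \<beta>}"
proof -
  let ?W = "{j. j < length b \<and> ranked_above b \<beta> j < K}"
  have mono: "ranked_above b \<beta> i \<le> ranked_above b \<beta> j" if "i \<le> j" "j < length b" for i j
  proof -
    have ge: "b ! j \<le> b ! i"
      using assms that by (cases "i = j") (auto simp: sorted_wrt_iff_nth_less)
    show ?thesis
      unfolding ranked_above_def using that ge by (intro add_mono card_mono) auto
  qed
  have "\<exists>n. ?W = {..<n}"
  proof (cases "?W = {}")
    case False
    define k where "k = Max ?W"
    have k: "k \<in> ?W" unfolding k_def using False by (intro Max_in) auto
    have le: "j \<le> k" if "j \<in> ?W" for j unfolding k_def using that by (intro Max_ge) auto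
    have "?W = {..<Suc k}"
      using le k mono[of _ k] by (auto simp: less_Suc_eq_le) (meson le_trans not_less)
    then show ?thesis ..
  qed auto
  then obtain n where n: "?W = {..<n}" ..
  moreover have "allocation K b \<beta> = n"
    unfolding allocation_def n by simp
  ultimately show ?thesis by simp
qed

lemma sum_list_take: "n \<le> length v \<Longrightarrow> sum_list (take n v) = (\<Sum>j<n. v ! j)"
  for v :: "real list"
  by (simp add: sum_list_sum_nth lessThan_atLeast0 min_def)

lemma sum_segments:
  fixes f :: "nat \<Rightarrow> real"
  assumes "k \<le> length s"
  shows "(\<Sum>j<cum s k. f j) = (\<Sum>l<k. \<Sum>j\<in>{cum s l..<cum s (Suc l)}. f j)"
  using assms
proof (induction k)
  case (Suc k)
  have "(\<Sum>j<cum s (Suc k). f j) = (\<Sum>j<cum s k. f j) + (\<Sum>j\<in>{cum s k..<cum s (Suc k)}. f j)"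
    using cum_mono[of k "Suc k" s]
    by (simp add: lessThan_atLeast0 sum.atLeastLessThan_concat)
  then show ?case using Suc by simp
qed (simp add: cum_0)

lemma edge_weight_eq:
  "edge_weight v K \<beta> (Node l z) (Node l' z') =
    (\<Sum>j\<in>{z..<z'}. v ! j * of_bool (threshold K \<beta> (Suc j) \<le> avg v z'))"
  unfolding edge_weight.simps
  by (rule sum.reindex_bij_witness[of _ Suc "\<lambda>j. j - 1"]) auto

lemma strategiesD:
  assumes "s \<in> strategies v m"
  shows "1 \<le> length s" "length s \<le> m" "sorted_wrt (>) (map fst s)"
    "\<And>b q. (b, q) \<in> set s \<Longrightarrow> 0 < b \<and> 0 < q"
    "cum s (length s) \<le> length v"
    "\<And>l. l < length s \<Longrightarrow> fst (s ! l) = avg v (cum s (Suc l))"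
proof -
  from assms obtain k where k: "k \<in> {1..m}" "uniform_strategy (length v) k s"
    "\<forall>l\<in>{1..k}. fst (s ! (l - 1)) = avg v (cum s l)"
    by (auto simp: strategies_def)
  then have "length s = k" by (simp add: uniform_strategy_def)
  then show "1 \<le> length s" "length s \<le> m" "sorted_wrt (>) (map fst s)"
    "\<And>b q. (b, q) \<in> set s \<Longrightarrow> 0 < b \<and> 0 < q"
    "cum s (length s) \<le> length v"
    using k by (auto simp: uniform_strategy_def)
  show "fst (s ! l) = avg v (cum s (Suc l))" if "l < length s" for l
    using k(3)[rule_format, of "Suc l"] that \<open>length s = k\<close> by simp
qed

lemma strategiesI:
  assumes "1 \<le> length s" "length s \<le> m" "sorted_wrt (>) (map fst s)"
    "\<And>b q. (b, q) \<in> set s \<Longrightarrow> 0 < b \<and> 0 < q"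
    "cum s (length s) \<le> length v"
    "\<And>l. l < length s \<Longrightarrow> fst (s ! l) = avg v (cum s (Suc l))"
  shows "s \<in> strategies v m"
proof -
  have "fst (s ! (l - 1)) = avg v (cum s l)" if "l \<in> {1..length s}" for l
    using assms(6)[of "l - 1"] that by (cases l) auto
  then show ?thesis
    using assms unfolding strategies_def uniform_strategy_def by auto
qed

lemma obtained_value_eq_path_weight:
  assumes s: "s \<in> strategies v m" and K: "length v \<le> K"
  shows "obtained_value v K s \<beta> =
    (\<Sum>l<length s. edge_weight v K \<beta> (Node l (cum s l)) (Node (Suc l) (cum s (Suc l))))"
proof -
  let ?b = "bid_vector s" and ?n = "cum s (length s)"
  note S = strategiesD[OF s]
  have sorted: "sorted_wrt (\<ge>) ?b" by (rule sorted_bid_vector[OF S(3)])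
  have len: "length ?b = ?n" by (rule length_bid_vector)
  have pos: "0 \<le> ?b ! j" if "j < ?n" for j
  proof -
    have "?b ! j \<in> fst ` set s" using set_bid_vector[of s] that len by (metis nth_mem subsetD)
    then show ?thesis using S(4) by force
  qed
  \<comment> \<open>Each own position is below \<open>length v \<le> K\<close>, which provides the
    side condition \<open>j < K\<close> of the threshold criterion.\<close>
  have W: "j < allocation K ?b \<beta> \<longleftrightarrow> j < ?n \<and> threshold K \<beta> (Suc j) \<le> ?b ! j" for j
  proof -
    have "j < allocation K ?b \<beta> \<longleftrightarrow> j < ?n \<and> ranked_above ?b \<beta> j < K"
      using winning_bids_eq[OF sorted, of \<beta> K] len by auto
    also have "\<dots> \<longleftrightarrow> j < ?n \<and> threshold K \<beta> (Suc j) \<le> ?b ! j"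
      using ranked_above_less_iff[OF sorted, of j K \<beta>] pos[of j] len S(5) K by auto
    finally show ?thesis .
  qed
  have "allocation K ?b \<beta> \<le> ?n" using W by (meson leI less_irrefl)
  then have "obtained_value v K s \<beta> = (\<Sum>j<allocation K ?b \<beta>. v ! j)"
    unfolding obtained_value_def using S(5) by (subst sum_list_take) auto
  also have "\<dots> = (\<Sum>j<?n. v ! j * of_bool (threshold K \<beta> (Suc j) \<le> ?b ! j))"
  proof -
    have "{..<allocation K ?b \<beta>} = {j \<in> {..<?n}. threshold K \<beta> (Suc j) \<le> ?b ! j}"
      using W by blast
    then have "(\<Sum>j<allocation K ?b \<beta>. v ! j) =
        (\<Sum>j<?n. if threshold K \<beta> (Suc j) \<le> ?b ! j then v ! j else 0)"
      by (simp only: sum.inter_filter[OF finite_lessThan])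
    then show ?thesis by (simp only: of_bool_def if_distrib[of "(*) _"] mult_1_right mult_zero_right)
  qed
  also have "\<dots> = (\<Sum>l<length s. \<Sum>j\<in>{cum s l..<cum s (Suc l)}.
      v ! j * of_bool (threshold K \<beta> (Suc j) \<le> ?b ! j))"
    by (rule sum_segments) simp
  also have "\<dots> = (\<Sum>l<length s. edge_weight v K \<beta> (Node l (cum s l)) (Node (Suc l) (cum s (Suc l))))"
    unfolding edge_weight_eq
  proof (intro sum.cong refl)
    fix l j assume "l \<in> {..<length s}" "j \<in> {cum s l..<cum s (Suc l)}"
    then show "v ! j * of_bool (threshold K \<beta> (Suc j) \<le> ?b ! j) =
        v ! j * of_bool (threshold K \<beta> (Suc j) \<le> avg v (cum s (Suc l)))"
      using nth_bid_vector[of l s j] S(6)[of l] by simp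
  qed
  finally show ?thesis .
qed

section \<open>Weight pushing\<close>

lemma edge_cases:
  assumes "edge v m u x"
  obtains (inner) l z z' where "u = Node l z" "x = Node (Suc l) z'"
    | (last) l z where "u = Node l z" "x = Sink"
  using assms by (cases u; cases x) auto

lemma finite_edges: "finite {x. edge v m u x}"
proof (rule finite_subset)
  show "{x. edge v m u x} \<subseteq> insert Sink ((\<lambda>(l, z). Node l z) ` ({..m} \<times> {..length v}))"
  proof
    fix x assume "x \<in> {x. edge v m u x}"
    then have x: "edge v m u x" by simp
    then show "x \<in> insert Sink ((\<lambda>(l, z). Node l z) ` ({..m} \<times> {..length v}))"
    proof (cases rule: edge_cases)
      case (inner l z z')
      then have "Suc l \<le> m" "z' \<le> length v" using x by auto
      then show ?thesis using inner by force
    qed simp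
  qed
qed simp

text \<open>There are no dead ends: every inner node that can be reached may stop at once. This
  keeps potentials positive.\<close>

lemma edge_target_to_Sink: "edge v m u x \<Longrightarrow> x = Sink \<or> edge v m x Sink"
  by (cases u; cases x) auto

lemma potential_pos:
  assumes "\<And>u x. edge v m u x \<Longrightarrow> 0 < g u x" "u = Sink \<or> (\<exists>x. edge v m u x)"
  shows "0 < potential v m g u"
  using assms
proof (induction v m g u rule: potential.induct)
  case (2 v m g l z)
  have "0 < g (Node l z) x * potential v m g x" if "edge v m (Node l z) x" for x
    using that 2 edge_target_to_Sink[OF that] by (intro mult_pos_pos) auto
  then show ?case
    using 2 finite_edges[of v m "Node l z"] by (auto intro!: sum_pos)
qed simp

lemma push_weights_pos:
  assumes "\<And>u x. edge v m u x \<Longrightarrow> 0 < g u x" "edge v m u x"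
  shows "0 < push_weights v m g u x"
proof -
  have "0 < potential v m g x" "0 < potential v m g u"
    using assms edge_target_to_Sink[OF assms(2)] by (auto intro!: potential_pos)
  then show ?thesis using assms by (simp add: push_weights_def)
qed

text \<open>The potential of \<open>u\<close> is by definition the sum of the numerators, so pushing
  normalizes at each node even if \<open>g\<close> does not.\<close>

lemma sum_push_weights:
  assumes "\<And>u x. edge v m u x \<Longrightarrow> 0 < g u x" "edge v m u x0"
  shows "(\<Sum>x | edge v m u x. push_weights v m g u x) = 1"
proof -
  from assms(2) obtain l z where u: "u = Node l z" by (auto elim: edge_cases)
  have "(\<Sum>x | edge v m u x. push_weights v m g u x) = potential v m g u / potential v m g u"
    unfolding push_weights_def sum_divide_distrib[symmetric] u by simp
  also have "\<dots> = 1" using potential_pos[of v m g u] assms by force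
  finally show ?thesis .
qed

lemma edge_prob_pos: "edge v m u x \<Longrightarrow> 0 < edge_prob \<eta> v m K \<beta> t u x"
  by (induction t arbitrary: u x) (auto intro!: push_weights_pos)

lemma sum_edge_prob:
  assumes "edge v m u x0"
  shows "(\<Sum>x | edge v m u x. edge_prob \<eta> v m K \<beta> t u x) = 1"
  using assms by (cases t) (auto intro!: sum_push_weights mult_pos_pos edge_prob_pos)

section \<open>Paths of strategies and their probabilities\<close>

lemma length_path_of: "length (path_of s) = length s + 2"
  by (simp add: path_of_def del: upt_Suc)

lemma nth_path_of: "i \<le> length s \<Longrightarrow> path_of s ! i = Node i (cum s i)"
  by (cases i) (auto simp: path_of_def nth_append cum_0 simp del: upt_Suc)

lemma nth_path_of_last: "path_of s ! Suc (length s) = Sink"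
  by (simp add: path_of_def nth_append del: upt_Suc)

lemma path_prob_path_of:
  "path_prob g (path_of s) =
    (\<Prod>i<length s. g (Node i (cum s i)) (Node (Suc i) (cum s (Suc i)))) *
    g (Node (length s) (cum s (length s))) Sink"
  by (simp add: path_prob_def length_path_of nth_path_of nth_path_of_last)

lemma cum_pos:
  assumes "s \<in> strategies v m" "1 \<le> l" "l \<le> length s"
  shows "1 \<le> cum s l"
proof -
  have "0 < snd (s ! 0)"
    using strategiesD(1,4)[OF assms(1)] by (metis One_nat_def Suc_le_lessD nth_mem prod.collapse)
  then have "1 \<le> cum s 1"
    using strategiesD(1)[OF assms(1)] cum_Suc[of 0 s] by (cases s) (simp_all add: cum_0)
  then show ?thesis using cum_mono[OF assms(2), of s] by simp
qed

lemma strategy_edges: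
  assumes "s \<in> strategies v m"
  shows "i < length s \<Longrightarrow> edge v m (Node i (cum s i)) (Node (Suc i) (cum s (Suc i)))"
    and "edge v m (Node (length s) (cum s (length s))) Sink"
proof -
  note S = strategiesD[OF assms]
  show "edge v m (Node (length s) (cum s (length s))) Sink"
    using S cum_pos[OF assms, of "length s"] by auto
  assume i: "i < length s"
  have "0 < snd (s ! i)" using S(4) i by (metis nth_mem prod.collapse)
  moreover have "cum s (Suc i) \<le> length v"
    using S(5) cum_mono[of "Suc i" "length s" s] i by simp
  moreover have "avg v (cum s i) > avg v (cum s (Suc i))" if nz: "i \<noteq> 0"
  proof -
    obtain i' where i': "i = Suc i'" using nz by (cases i) auto
    have "fst (s ! i) < fst (s ! i')"
      using S(3) i i' by (simp add: sorted_wrt_iff_nth_less)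
    then show ?thesis using S(6) i i' by auto
  qed
  ultimately show "edge v m (Node i (cum s i)) (Node (Suc i) (cum s (Suc i)))"
    using i S(2) cum_pos[OF assms, of i] by (auto simp: cum_Suc cum_0)
qed

lemma prod_telescope:
  fixes a P :: "nat \<Rightarrow> real"
  assumes "\<And>i. i \<le> n \<Longrightarrow> P i \<noteq> 0"
  shows "(\<Prod>i<n. a i * P (Suc i) / P i) = (\<Prod>i<n. a i) * P n / P 0"
  using assms
proof (induction n)
  case (Suc n)
  have "P n \<noteq> 0" using Suc.prems[of n] by simp
  then show ?case using Suc by simp
qed simp

lemma path_prob_push_weights:
  assumes "\<And>u x. edge v m u x \<Longrightarrow> 0 < g u x" "s \<in> strategies v m"
  shows "path_prob (push_weights v m g) (path_of s) = path_prob g (path_of s) / potential v m g (Node 0 0)"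
proof -
  let ?P = "\<lambda>i. potential v m g (Node i (cum s i))"
  have P: "?P i \<noteq> 0" if "i \<le> length s" for i
  proof -
    have "\<exists>x. edge v m (Node i (cum s i)) x"
      using strategy_edges[OF assms(2)] that by (cases "i < length s") (auto simp del: edge.simps)
    then have "0 < ?P i" using assms(1) by (intro potential_pos) auto
    then show ?thesis by simp
  qed
  have "(\<Prod>i<length s. push_weights v m g (Node i (cum s i)) (Node (Suc i) (cum s (Suc i)))) =
      (\<Prod>i<length s. g (Node i (cum s i)) (Node (Suc i) (cum s (Suc i)))) * ?P (length s) / ?P 0"
    unfolding push_weights_def by (rule prod_telescope) (rule P)
  \<comment> \<open>The edge into the sink contributes the factor 1 over the potential of the last
    inner node, as the sink has potential 1; only the source potential survives.\<close>
  then show ?thesis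
    using P[of "length s"] unfolding path_prob_path_of
    by (simp only: push_weights_def cum_0 potential.simps(1)) simp
qed

text \<open>\<open>Z\<close> is the product of the source potentials of all pushes so far. It may
  stay existential, since the total mass 1 identifies it in
  \<open>path_prob_eq_hedge_prob\<close>.\<close>

lemma path_prob_edge_prob_proportional:
  assumes "length v \<le> K" "strategies v m \<noteq> {}"
  shows "\<exists>Z>0. \<forall>s\<in>strategies v m. path_prob (edge_prob \<eta> v m K \<beta> t) (path_of s) =
    exp (\<eta> * (\<Sum>\<tau><t. obtained_value v K s (\<beta> \<tau>))) / Z"
proof -
  have source: "\<exists>x. edge v m (Node 0 0) x"
  proof -
    obtain s where s: "s \<in> strategies v m" using assms(2) by auto
    then have "0 < length s" using strategiesD(1)[OF s] by linarith
    then show ?thesis using strategy_edges(1)[OF s, of 0] unfolding cum_0 by blast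
  qed
  show ?thesis
  proof (induction t)
    case 0
    have "0 < potential v m (\<lambda>_ _. 1) (Node 0 0)"
      using source by (intro potential_pos) auto
    moreover have "path_prob (edge_prob \<eta> v m K \<beta> 0) (path_of s) =
        1 / potential v m (\<lambda>_ _. 1) (Node 0 0)" if "s \<in> strategies v m" for s
      using that by (subst edge_prob.simps, subst path_prob_push_weights) (simp_all only: path_prob_path_of, simp_all)
    ultimately show ?case by (intro exI[of _ "potential v m (\<lambda>_ _. 1) (Node 0 0)"]) simp
  next
    case (Suc t)
    let ?g = "\<lambda>u x. edge_prob \<eta> v m K \<beta> t u x * exp (\<eta> * edge_weight v K (\<beta> t) u x)"
    from Suc obtain Z where Z: "Z > 0" "\<And>s. s \<in> strategies v m \<Longrightarrow>
        path_prob (edge_prob \<eta> v m K \<beta> t) (path_of s) =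
        exp (\<eta> * (\<Sum>\<tau><t. obtained_value v K s (\<beta> \<tau>))) / Z" by auto
    have g: "0 < ?g u x" if "edge v m u x" for u x
      using edge_prob_pos[OF that] by simp
    have Z': "0 < potential v m ?g (Node 0 0)"
      using source g by (intro potential_pos) auto
    have "path_prob (edge_prob \<eta> v m K \<beta> (Suc t)) (path_of s) =
        exp (\<eta> * (\<Sum>\<tau><Suc t. obtained_value v K s (\<beta> \<tau>))) / (Z * potential v m ?g (Node 0 0))"
      if s: "s \<in> strategies v m" for s
    proof -
      have "path_prob ?g (path_of s) =
          path_prob (edge_prob \<eta> v m K \<beta> t) (path_of s) * exp (\<eta> * obtained_value v K s (\<beta> t))"
        unfolding path_prob_path_of obtained_value_eq_path_weight[OF s assms(1)]
        by (simp add: prod.distrib exp_sum sum_distrib_left del: edge_weight.simps(1))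
      then show ?thesis
        using path_prob_push_weights[of v m ?g, OF g s] Z(2)[OF s]
        by (simp add: exp_add distrib_left field_simps del: potential.simps(2))
    qed
    then show ?case using Z(1) Z' by (intro exI[of _ "Z * potential v m ?g (Node 0 0)"]) simp
  qed
qed

lemma path_prob_eq_hedge_prob:
  assumes "length v \<le> K"
    and sum: "(\<Sum>s\<in>strategies v m. path_prob (edge_prob \<eta> v m K \<beta> t) (path_of s)) = 1"
    and s: "s \<in> strategies v m"
  shows "path_prob (edge_prob \<eta> v m K \<beta> t) (path_of s) = hedge_prob \<eta> v m K \<beta> t s"
proof -
  obtain Z where Z: "Z > 0" "\<And>s. s \<in> strategies v m \<Longrightarrow>
      path_prob (edge_prob \<eta> v m K \<beta> t) (path_of s) =
      exp (\<eta> * (\<Sum>\<tau><t. obtained_value v K s (\<beta> \<tau>))) / Z"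
    using path_prob_edge_prob_proportional[OF assms(1), of m \<eta> \<beta> t] s by auto
  have "(\<Sum>s\<in>strategies v m. exp (\<eta> * (\<Sum>\<tau><t. obtained_value v K s (\<beta> \<tau>)))) / Z = 1"
    using sum by (simp add: Z(2) sum_divide_distrib)
  then have "(\<Sum>s\<in>strategies v m. exp (\<eta> * (\<Sum>\<tau><t. obtained_value v K s (\<beta> \<tau>)))) = Z"
    using Z(1) by simp
  then show ?thesis unfolding hedge_prob_def using Z(2)[OF s] by simp
qed

section \<open>The DAG as an absorbing Markov chain\<close>

text \<open>Numbering the nodes of a layer by the quantity \<open>z\<close>, the sink is the unused number 0 of every
  layer but the first, with a self-loop.  All paths then have the same number of steps.\<close>

definition layer_node :: "nat \<Rightarrow> nat \<Rightarrow> node" where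
  "layer_node l z = (if 0 < l \<and> z = 0 then Sink else Node l z)"

text \<open>Total on all pairs of numbers, so that it can be the content of an array: the fallback
  is 1 at the self-loop of the sink and 0 at every other non-edge.\<close>

definition chain_prob :: "real list \<Rightarrow> nat \<Rightarrow> (node \<Rightarrow> node \<Rightarrow> real) \<Rightarrow> nat \<Rightarrow> nat \<Rightarrow> nat \<Rightarrow> real" where
  "chain_prob v m g l z y =
    (if edge v m (layer_node l z) (layer_node (Suc l) y)
     then g (layer_node l z) (layer_node (Suc l) y) else of_bool (0 < l \<and> z = 0 \<and> y = 0))"

lemma edge_layer_node:
  "edge v m (layer_node l z) (layer_node (Suc l) y) \<longleftrightarrow>
    (if y = 0 then l \<in> {1..m} \<and> z \<in> {1..length v}
     else l < m \<and> z < y \<and> y \<le> length v \<and> (if l = 0 then z = 0 else 1 \<le> z \<and> avg v z > avg v y))"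
  by (auto simp: layer_node_def)

lemma chain_prob_absorbing: "0 < l \<Longrightarrow> chain_prob v m g l 0 y = of_bool (y = 0)"
  by (simp add: chain_prob_def layer_node_def)

lemma sum_over_edges:
  "(\<Sum>y\<le>length v. if edge v m (layer_node l z) (layer_node (Suc l) y) then h (layer_node (Suc l) y) else 0)
    = (\<Sum>x | edge v m (layer_node l z) x. h x)"
  for h :: "node \<Rightarrow> real"
proof -
  have "(\<Sum>x | edge v m (layer_node l z) x. h x) =
      (\<Sum>y | y \<le> length v \<and> edge v m (layer_node l z) (layer_node (Suc l) y). h (layer_node (Suc l) y))"
  proof (rule sum.reindex_bij_betw[symmetric], rule bij_betw_imageI)
    show "inj_on (layer_node (Suc l)) {y. y \<le> length v \<and> edge v m (layer_node l z) (layer_node (Suc l) y)}"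
      by (auto simp: inj_on_def layer_node_def split: if_splits)
    show "layer_node (Suc l) ` {y. y \<le> length v \<and> edge v m (layer_node l z) (layer_node (Suc l) y)} =
        {x. edge v m (layer_node l z) x}"
    proof (intro equalityI subsetI)
      fix x assume "x \<in> {x. edge v m (layer_node l z) x}"
      then have x: "edge v m (layer_node l z) x" by simp
      then show "x \<in> layer_node (Suc l) ` {y. y \<le> length v \<and> edge v m (layer_node l z) (layer_node (Suc l) y)}"
      proof (cases rule: edge_cases)
        case (inner l' z1 z')
        then have "x = layer_node (Suc l) z'" "z' \<le> length v"
          using x by (auto simp: layer_node_def split: if_splits)
        then show ?thesis using x by auto
      next
        case last
        then have "x = layer_node (Suc l) 0" by (simp add: layer_node_def)
        then show ?thesis using x by (intro image_eqI[of _ _ 0]) simp_all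
      qed
    qed auto
  qed
  also have "\<dots> = (\<Sum>y\<in>{y\<in>{..length v}. edge v m (layer_node l z) (layer_node (Suc l) y)}. h (layer_node (Suc l) y))"
    by simp
  also have "\<dots> = (\<Sum>y\<le>length v. if edge v m (layer_node l z) (layer_node (Suc l) y) then h (layer_node (Suc l) y) else 0)"
    by (rule sum.inter_filter) simp
  finally show ?thesis by simp
qed

lemma chain_prob_nonneg:
  "(\<And>u x. edge v m u x \<Longrightarrow> 0 < g u x) \<Longrightarrow> 0 \<le> chain_prob v m g l z y"
  by (auto simp: chain_prob_def less_imp_le)

lemma sum_chain_prob:
  assumes "1 \<le> m" "v \<noteq> []" "l \<le> m" "z \<le> length v" "l = 0 \<Longrightarrow> z = 0"
  shows "(\<Sum>y\<le>length v. chain_prob v m (edge_prob \<eta> v m K \<beta> t) l z y) = 1"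
proof (cases "0 < l \<and> z = 0")
  case True
  then show ?thesis by (simp add: chain_prob_absorbing)
next
  case False
  let ?\<phi> = "edge_prob \<eta> v m K \<beta> t"
  \<comment> \<open>A witness that an edge leaves the node: the source may go to quantity 1, every
    other node may stop.\<close>
  have "edge v m (layer_node l z) (layer_node (Suc l) (if l = 0 then 1 else 0))"
    unfolding edge_layer_node using assms False by (cases v) auto
  then have "(\<Sum>x | edge v m (layer_node l z) x. ?\<phi> (layer_node l z) x) = 1"
    by (rule sum_edge_prob)
  then have "(\<Sum>y\<le>length v. if edge v m (layer_node l z) (layer_node (Suc l) y)
      then ?\<phi> (layer_node l z) (layer_node (Suc l) y) else 0) = 1"
    unfolding sum_over_edges .
  moreover have "chain_prob v m ?\<phi> l z y = (if edge v m (layer_node l z) (layer_node (Suc l) y)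
      then ?\<phi> (layer_node l z) (layer_node (Suc l) y) else 0)" for y
    using False by (auto simp: chain_prob_def)
  ultimately show ?thesis by simp
qed

text \<open>The recursion as a matrix-vector product over a fixed index range, the form in which the
  program evaluates it.\<close>

lemma potential_layer_node:
  "potential v m g (layer_node l z) =
    (\<Sum>y\<le>length v. chain_prob v m g l z y * potential v m g (layer_node (Suc l) y))"
proof (cases "0 < l \<and> z = 0")
  case True
  then have "(\<Sum>y\<le>length v. chain_prob v m g l z y * potential v m g (layer_node (Suc l) y)) =
      potential v m g (layer_node (Suc l) 0)"
    by (subst sum.remove[of _ 0]) (auto simp: chain_prob_absorbing intro!: sum.neutral)
  then show ?thesis using True by (simp add: layer_node_def)
next
  case False
  have "potential v m g (layer_node l z) =
      (\<Sum>x | edge v m (layer_node l z) x. g (layer_node l z) x * potential v m g x)"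
    using False by (simp add: layer_node_def)
  also have "\<dots> = (\<Sum>y\<le>length v. chain_prob v m g l z y * potential v m g (layer_node (Suc l) y))"
    unfolding sum_over_edges[symmetric] using False
    by (intro sum.cong) (auto simp: chain_prob_def)
  finally show ?thesis .
qed

text \<open>Boundary values of the backward recursion: in layer m + 1 only the sink carries
  potential.\<close>

lemma potential_beyond_last_layer: "potential v m g (layer_node (Suc m) y) = of_bool (y = 0)"
proof (cases "y = 0")
  case False
  have "\<not> edge v m (Node (Suc m) y) x" for x by (cases x) auto
  then have "potential v m g (Node (Suc m) y) = 0"
    unfolding potential.simps by (intro sum.neutral) blast
  then show ?thesis using False by (simp add: layer_node_def)
qed (simp add: layer_node_def)

text \<open>Valid at every entry: at the self-loop both potentials are 1, and at other non-edges
  both sides are 0, even when the denominator is 0. Hence the program may divide without an edge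
  test.\<close>

lemma chain_prob_push_weights:
  "chain_prob v m (push_weights v m g) l z y =
    chain_prob v m g l z y * potential v m g (layer_node (Suc l) y) / potential v m g (layer_node l z)"
  by (auto simp: chain_prob_def push_weights_def layer_node_def simp del: potential.simps(2))

text \<open>For a step into the sink, \<open>y = 0\<close>, the interval is empty and the factor is
  1, in accordance with the weight 0 of such edges.\<close>

lemma chain_prob_reweight:
  "chain_prob v m (\<lambda>u x. g u x * exp (\<eta> * edge_weight v K b u x)) l z y =
    chain_prob v m g l z y *
      exp (\<eta> * (\<Sum>j\<in>{z..<y}. v ! j * of_bool (threshold K b (Suc j) \<le> avg v y)))"
proof -
  have "edge_weight v K b (layer_node l z) (layer_node (Suc l) y) =
      (\<Sum>j\<in>{z..<y}. v ! j * of_bool (threshold K b (Suc j) \<le> avg v y))"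
    if "edge v m (layer_node l z) (layer_node (Suc l) y)"
  proof (cases "y = 0")
    case True
    then show ?thesis by (cases "layer_node l z") (auto simp: layer_node_def)
  next
    case False
    then have "layer_node l z = Node l z" "layer_node (Suc l) y = Node (Suc l) y"
      using that by (auto simp: edge_layer_node layer_node_def split: if_splits)
    then show ?thesis by (simp only: edge_weight_eq)
  qed
  then show ?thesis by (auto simp: chain_prob_def)
qed

section \<open>Walks of the chain and the strategies they produce\<close>

text \<open>\<open>walk v m G F n z s\<close> is the expectation of \<open>F\<close> at the strategy that results from \<open>n\<close> further
  steps of the chain, when the last cumulative quantity of the partial strategy \<open>s\<close> is \<open>z\<close>.\<close>

primrec walk ::
  "real list \<Rightarrow> nat \<Rightarrow> (nat \<Rightarrow> nat \<Rightarrow> nat \<Rightarrow> real) \<Rightarrow> (strategy \<Rightarrow> real) \<Rightarrow> nat \<Rightarrow> nat \<Rightarrow> strategy \<Rightarrow> real" where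
  "walk v m G F 0 z s = F s"
| "walk v m G F (Suc n) z s =
    (\<Sum>y\<le>length v. G (m - n) z y * walk v m G F n y (if 0 < y then s @ [(avg v y, y - z)] else s))"

lemma walk_absorbed: "n \<le> m \<Longrightarrow> walk v m (chain_prob v m g) F n 0 s = F s"
proof (induction n)
  case (Suc n)
  then have "0 < m - n" by simp
  then have "walk v m (chain_prob v m g) F (Suc n) 0 s = walk v m (chain_prob v m g) F n 0 s"
    unfolding walk.simps
    by (subst sum.remove[of _ 0]) (auto simp: chain_prob_absorbing intro!: sum.neutral)
  then show ?case using Suc by simp
qed simp

text \<open>A walk only appends pairs, so a list that is not a prefix of \<open>b\<close> never
  becomes \<open>b\<close>.\<close>

lemma walk_eq_0:
  assumes "take (length s) b \<noteq> s"
  shows "walk v m G (\<lambda>s. of_bool (s = b)) n z s = 0"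
  using assms
proof (induction n arbitrary: z s)
  case (Suc n)
  have "take (length (s @ [p])) b \<noteq> s @ [p]" for p
  proof
    assume "take (length (s @ [p])) b = s @ [p]"
    then have "take (length s) (take (length (s @ [p])) b) = s" by simp
    then show False using Suc.prems by simp
  qed
  then show ?case using Suc by (simp add: sum.neutral)
qed auto

text \<open>At each layer a single successor contributes: stopping before the end misses
  \<open>b\<close>, another larger quantity breaks the prefix, and a quantity that is not larger is
  no edge. The induction runs backwards from the end of \<open>b\<close>.\<close>

lemma walk_path:
  assumes b: "b \<in> strategies v m" and l: "l \<le> length b"
  shows "walk v m (chain_prob v m g) (\<lambda>s. of_bool (s = b)) (Suc m - l) (cum b l) (take l b) =
    (\<Prod>i\<in>{l..<length b}. g (Node i (cum b i)) (Node (Suc i) (cum b (Suc i)))) *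
    g (Node (length b) (cum b (length b))) Sink"
  using l
proof (induction rule: inc_induct)
  case base
  let ?k = "length b"
  note S = strategiesD[OF b]
  let ?w = "walk v m (chain_prob v m g) (\<lambda>s. of_bool (s = b)) (m - ?k)"
  have "walk v m (chain_prob v m g) (\<lambda>s. of_bool (s = b)) (Suc m - ?k) (cum b ?k) b =
      (\<Sum>y\<le>length v. chain_prob v m g ?k (cum b ?k) y *
        ?w y (if 0 < y then b @ [(avg v y, y - cum b ?k)] else b))"
    using S(2) by (simp add: Suc_diff_le)
  \<comment> \<open>Once all of \<open>b\<close> is present, any further pair overshoots it, so only
    stopping remains.\<close>
  also have "\<dots> = chain_prob v m g ?k (cum b ?k) 0 * ?w 0 b"
    by (subst sum.remove[of _ 0]) (auto intro!: sum.neutral walk_eq_0)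
  also have "?w 0 b = 1" using S by (subst walk_absorbed) auto
  also have "chain_prob v m g ?k (cum b ?k) 0 = g (Node ?k (cum b ?k)) Sink"
    using strategy_edges(2)[OF b] cum_pos[OF b, of ?k] S(1) by (simp add: chain_prob_def layer_node_def)
  finally show ?case by simp
next
  case (step l)
  note S = strategiesD[OF b]
  let ?w = "walk v m (chain_prob v m g) (\<lambda>s. of_bool (s = b)) (m - l)"
  let ?s = "\<lambda>y. if 0 < y then take l b @ [(avg v y, y - cum b l)] else take l b"
  have edge: "edge v m (Node l (cum b l)) (Node (Suc l) (cum b (Suc l)))"
    by (rule strategy_edges(1)[OF b step(2)])
  then have lt: "cum b l < cum b (Suc l)" "cum b (Suc l) \<le> length v" by auto
  have nodes: "layer_node l (cum b l) = Node l (cum b l)"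
      "layer_node (Suc l) (cum b (Suc l)) = Node (Suc l) (cum b (Suc l))"
    using cum_pos[OF b, of l] step(2) lt by (cases l; simp add: layer_node_def)+
  have step_eq: "take (Suc l) b = ?s (cum b (Suc l))"
    using S(6)[OF step(2)] lt step(2) by (simp add: take_Suc_conv_app_nth cum_Suc prod_eq_iff)
  have other: "chain_prob v m g l (cum b l) y * ?w y (?s y) = 0" if y: "y \<noteq> cum b (Suc l)" for y
  proof (cases "y = 0")
    case True
    show ?thesis
    proof (cases "l = 0")
      case True
      then show ?thesis using \<open>y = 0\<close> by (simp add: chain_prob_def edge_layer_node)
    next
      case False
      then have "?w 0 (take l b) = of_bool (take l b = b)" by (subst walk_absorbed) auto
      moreover have "take l b \<noteq> b" using step(2) by (metis length_take less_irrefl min_less_iff_conj)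
      ultimately show ?thesis using True by simp
    qed
  next
    case False
    show ?thesis
    proof (cases "cum b l < y")
      case True
      have "take (Suc l) b \<noteq> ?s y"
        unfolding step_eq using y True lt by auto
      then have "?w y (?s y) = 0"
        using step(2) False by (intro walk_eq_0) (auto simp: min_def)
      then show ?thesis by simp
    next
      case False
      then have "chain_prob v m g l (cum b l) y = 0"
        using \<open>y \<noteq> 0\<close> by (auto simp: chain_prob_def edge_layer_node)
      then show ?thesis by simp
    qed
  qed
  have "walk v m (chain_prob v m g) (\<lambda>s. of_bool (s = b)) (Suc m - l) (cum b l) (take l b) =
      (\<Sum>y\<le>length v. chain_prob v m g l (cum b l) y * ?w y (?s y))"
    using S(2) step(2) by (simp add: Suc_diff_le)
  also have "\<dots> = chain_prob v m g l (cum b l) (cum b (Suc l)) * ?w (cum b (Suc l)) (?s (cum b (Suc l)))"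
  proof -
    have "(\<Sum>y\<in>{..length v} - {cum b (Suc l)}. chain_prob v m g l (cum b l) y * ?w y (?s y)) = 0"
      by (intro sum.neutral ballI other) simp
    then show ?thesis using lt by (subst sum.remove[of _ "cum b (Suc l)"]) simp_all
  qed
  also have "chain_prob v m g l (cum b l) (cum b (Suc l)) = g (Node l (cum b l)) (Node (Suc l) (cum b (Suc l)))"
    using edge by (simp add: chain_prob_def nodes del: edge.simps)
  also have "?w (cum b (Suc l)) (?s (cum b (Suc l))) =
      (\<Prod>i\<in>{Suc l..<length b}. g (Node i (cum b i)) (Node (Suc i) (cum b (Suc i)))) *
      g (Node (length b) (cum b (length b))) Sink"
    using step.IH unfolding step_eq by simp
  finally show ?case
    using step(2) by (simp add: prod.atLeast_Suc_lessThan)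
qed

lemma walk_eq_path_prob:
  assumes "b \<in> strategies v m"
  shows "walk v m (chain_prob v m g) (\<lambda>s. of_bool (s = b)) (Suc m) 0 [] = path_prob g (path_of b)"
  using walk_path[OF assms, of 0 g] by (simp add: cum_0 path_prob_path_of lessThan_atLeast0)

lemma avg_pos: "valuation v \<Longrightarrow> 1 \<le> y \<Longrightarrow> y \<le> length v \<Longrightarrow> 0 < avg v y"
  unfolding avg_def valuation_def by (auto simp: sum_list_take lessThan_empty_iff intro!: divide_pos_pos sum_pos)

lemma singleton_strategy:
  assumes "valuation v" "1 \<le> m" "1 \<le> y" "y \<le> length v"
  shows "[(avg v y, y)] \<in> strategies v m"
  using assms avg_pos[of v y] by (intro strategiesI) (auto simp: cum_def)

text \<open>The condition on averages in an edge is exactly the strict decrease of the bids at the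
  junction.\<close>

lemma append_strategy:
  assumes v: "valuation v" and s: "s \<in> strategies v m" and l: "length s < m"
    and y: "cum s (length s) < y" "y \<le> length v" "avg v y < avg v (cum s (length s))"
  shows "s @ [(avg v y, y - cum s (length s))] \<in> strategies v m"
proof (rule strategiesI)
  note S = strategiesD[OF s]
  let ?s = "s @ [(avg v y, y - cum s (length s))]"
  have cum: "cum ?s (Suc (length s)) = y"
    using y by (simp add: cum_def)
  show "sorted_wrt (>) (map fst ?s)"
  proof -
    have "avg v y < fst p" if p: "p \<in> set s" for p
    proof -
      obtain i where i: "i < length s" "p = s ! i" using p by (auto simp: in_set_conv_nth)
      have "fst (s ! (length s - 1)) \<le> fst (s ! i)"
        using S(3) i by (cases "i = length s - 1") (auto simp: sorted_wrt_iff_nth_less intro: less_imp_le)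
      moreover have "fst (s ! (length s - 1)) = avg v (cum s (length s))"
        using S(6)[of "length s - 1"] S(1) by (cases s) simp_all
      ultimately show ?thesis using y i by simp
    qed
    then show ?thesis using S(3) by (auto simp: sorted_wrt_append)
  qed
  show "0 < b \<and> 0 < q" if "(b, q) \<in> set ?s" for b q
    using that S(4) avg_pos[OF v, of y] y by auto
  show "fst (?s ! l) = avg v (cum ?s (Suc l))" if "l < length ?s" for l
    using that S(6)[of l] cum cum_append[of "Suc l" s] by (cases "l = length s") (auto simp: nth_append)
  show "cum ?s (length ?s) \<le> length v" using cum y by simp
qed (use l in auto)

text \<open>From the first layer on, the partial list is itself a strategy, so stopping is always
  safe. The empty list is not one, which is why the step out of the source is treated apart. Along
  the way all continuation values are 1, and the row sums finish the argument.\<close>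

lemma walk_in_strategies:
  assumes v: "valuation v" and m: "1 \<le> m"
    and sum: "\<And>l z. l \<le> m \<Longrightarrow> z \<le> length v \<Longrightarrow> (l = 0 \<Longrightarrow> z = 0) \<Longrightarrow> (\<Sum>y\<le>length v. chain_prob v m g l z y) = 1"
  shows "walk v m (chain_prob v m g) (\<lambda>s. of_bool (s \<in> strategies v m)) (Suc m) 0 [] = 1"
proof -
  have "walk v m (chain_prob v m g) (\<lambda>s. of_bool (s \<in> strategies v m)) n z s = 1"
    if "n \<le> m" "s \<in> strategies v m" "z = 0 \<or> length s = Suc m - n \<and> cum s (Suc m - n) = z" for n z s
    using that
  proof (induction n arbitrary: z s)
    case (Suc n)
    show ?case
    proof (cases "z = 0")
      case True
      show ?thesis unfolding True using Suc.prems by (subst walk_absorbed) auto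
    next
      case False
      then have s: "length s = m - n" "cum s (length s) = z" using Suc.prems by auto
      have "z \<le> length v" using strategiesD(5)[OF Suc.prems(2)] s by simp
      have "chain_prob v m g (m - n) z y * walk v m (chain_prob v m g) (\<lambda>s. of_bool (s \<in> strategies v m)) n y
          (if 0 < y then s @ [(avg v y, y - z)] else s) = chain_prob v m g (m - n) z y" for y
      proof (cases "y = 0")
        case True
        then show ?thesis using Suc by simp
      next
        case y: False
        show ?thesis
        proof (cases "edge v m (layer_node (m - n) z) (layer_node (Suc (m - n)) y)")
          case True
          then have e: "m - n < m" "z < y" "y \<le> length v" "avg v z > avg v y"
            using y Suc.prems(1) by (auto simp: edge_layer_node)
          then have "s @ [(avg v y, y - z)] \<in> strategies v m"
            using append_strategy[OF v Suc.prems(2), of y] s by auto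
          moreover have "cum (s @ [(avg v y, y - z)]) (Suc (length s)) = y"
            using s e by (simp add: cum_def)
          moreover have "Suc m - n = Suc (length s)" using s Suc.prems(1) by simp
          ultimately have "walk v m (chain_prob v m g) (\<lambda>s. of_bool (s \<in> strategies v m)) n y
              (s @ [(avg v y, y - z)]) = 1"
            using Suc.prems(1) by (intro Suc.IH) auto
          then show ?thesis using y by simp
        next
          case False
          then have "chain_prob v m g (m - n) z y = 0" using y by (simp add: chain_prob_def)
          then show ?thesis by simp
        qed
      qed
      then show ?thesis
        unfolding walk.simps using sum[of "m - n" z] Suc.prems(1) \<open>z \<le> length v\<close> by (simp only:)
    qed
  qed auto
  note step = this
  have "chain_prob v m g 0 0 y * walk v m (chain_prob v m g) (\<lambda>s. of_bool (s \<in> strategies v m)) m y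
      (if 0 < y then [(avg v y, y)] else []) = chain_prob v m g 0 0 y" for y
  proof (cases "y \<noteq> 0 \<and> y \<le> length v")
    case True
    then have "[(avg v y, y)] \<in> strategies v m"
      using singleton_strategy[OF v m] by simp
    moreover have "cum [(avg v y, y)] 1 = y" by (simp add: cum_def)
    ultimately have "walk v m (chain_prob v m g) (\<lambda>s. of_bool (s \<in> strategies v m)) m y [(avg v y, y)] = 1"
      by (intro step) auto
    then show ?thesis using True by simp
  next
    case False
    then have "chain_prob v m g 0 0 y = 0" by (auto simp: chain_prob_def edge_layer_node)
    then show ?thesis by simp
  qed
  moreover have "(\<Sum>y\<le>length v. chain_prob v m g 0 0 y) = 1" using sum[of 0 0] by simp
  ultimately show ?thesis
    unfolding walk.simps by (simp only: diff_self_eq_0 minus_nat.diff_0 append_Nil)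
qed

section \<open>The regret of Hedge\<close>

text \<open>Potential argument: the total weight starts at \<open>card E\<close>, grows per round by
  at most the factor \<open>exp (\<eta> * G t + (\<eta> * B)\<^sup>2)\<close>, and dominates the
  weight of the single expert \<open>b\<close>.\<close>

lemma hedge_regret:
  fixes x :: "nat \<Rightarrow> 'a \<Rightarrow> real"
  assumes E: "finite E" "b \<in> E" and \<eta>: "0 < \<eta>" "\<eta> * B \<le> 1"
    and x: "\<And>t e. e \<in> E \<Longrightarrow> 0 \<le> x t e \<and> x t e \<le> B"
  defines "W \<equiv> \<lambda>t. \<Sum>e\<in>E. exp (\<eta> * (\<Sum>\<tau><t. x \<tau> e))"
  defines "G \<equiv> \<lambda>t. \<Sum>e\<in>E. exp (\<eta> * (\<Sum>\<tau><t. x \<tau> e)) / W t * x t e"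
  shows "(\<Sum>t<T. x t b) - (\<Sum>t<T. G t) \<le> ln (card E) / \<eta> + \<eta> * T * B\<^sup>2"
proof -
  have W_pos: "0 < W t" for t
    unfolding W_def using E by (intro sum_pos) auto
  have card: "0 < real (card E)" using E card_gt_0_iff by auto
  have step: "W (Suc t) \<le> W t * exp (\<eta> * G t + (\<eta> * B)\<^sup>2)" for t
  proof -
    let ?w = "\<lambda>e. exp (\<eta> * (\<Sum>\<tau><t. x \<tau> e))"
    have WG: "W t * G t = (\<Sum>e\<in>E. ?w e * x t e)"
      unfolding G_def sum_distrib_left using W_pos[of t] by simp
    have "W (Suc t) = (\<Sum>e\<in>E. ?w e * exp (\<eta> * x t e))"
      by (simp add: W_def distrib_left exp_add)
    also have "\<dots> \<le> (\<Sum>e\<in>E. ?w e * (1 + \<eta> * x t e + (\<eta> * B)\<^sup>2))"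
    proof (intro sum_mono mult_left_mono)
      fix e assume e: "e \<in> E"
      have "\<eta> * x t e \<le> \<eta> * B" using x[OF e] \<eta> by simp
      moreover have "0 \<le> \<eta> * x t e" using x[OF e, of t] \<eta> by simp
      \<comment> \<open>The bound exp x \<le> 1 + x + x^2 is available for x between 0 and 1; this
        is where nonnegative gains and \<open>\<eta> * B \<le> 1\<close> enter.\<close>
      ultimately have "exp (\<eta> * x t e) \<le> 1 + \<eta> * x t e + (\<eta> * x t e)\<^sup>2" "(\<eta> * x t e)\<^sup>2 \<le> (\<eta> * B)\<^sup>2"
        using \<eta>(2) by (auto intro!: exp_bound power_mono)
      then show "exp (\<eta> * x t e) \<le> 1 + \<eta> * x t e + (\<eta> * B)\<^sup>2" by simp
    qed simp
    also have "\<dots> = W t * (1 + (\<eta> * G t + (\<eta> * B)\<^sup>2))"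
    proof -
      have "(\<Sum>e\<in>E. ?w e * (1 + \<eta> * x t e + c)) = (\<Sum>e\<in>E. ?w e) + \<eta> * (\<Sum>e\<in>E. ?w e * x t e) + (\<Sum>e\<in>E. ?w e) * c" for c
        by (simp add: distrib_left sum.distrib sum_distrib_left[of \<eta> _ E] sum_distrib_right mult.left_commute)
      moreover have "W t = (\<Sum>e\<in>E. ?w e)" by (simp add: W_def)
      ultimately show ?thesis
        unfolding WG[symmetric] by (simp only: distrib_left mult_1_right mult.left_commute[of _ \<eta>] add.assoc)
    qed
    also have "\<dots> \<le> W t * exp (\<eta> * G t + (\<eta> * B)\<^sup>2)"
      using W_pos[of t] by (intro mult_left_mono exp_ge_add_one_self) simp
    finally show ?thesis .
  qed
  have "W T \<le> card E * exp (\<eta> * (\<Sum>t<T. G t) + T * (\<eta> * B)\<^sup>2)"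
  proof (induction T)
    case 0
    then show ?case by (simp add: W_def)
  next
    case (Suc T)
    have "W (Suc T) \<le> W T * exp (\<eta> * G T + (\<eta> * B)\<^sup>2)" by (rule step)
    also have "\<dots> \<le> card E * exp (\<eta> * (\<Sum>t<T. G t) + T * (\<eta> * B)\<^sup>2) * exp (\<eta> * G T + (\<eta> * B)\<^sup>2)"
      using Suc by (intro mult_right_mono) auto
    also have "\<dots> = card E * exp (\<eta> * (\<Sum>t<Suc T. G t) + Suc T * (\<eta> * B)\<^sup>2)"
      by (simp add: exp_add[symmetric] algebra_simps)
    finally show ?case .
  qed
  moreover have "exp (\<eta> * (\<Sum>t<T. x t b)) \<le> W T"
    unfolding W_def using E by (intro member_le_sum) auto
  ultimately have "exp (\<eta> * (\<Sum>t<T. x t b)) \<le> exp (ln (card E) + (\<eta> * (\<Sum>t<T. G t) + T * (\<eta> * B)\<^sup>2))"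
    using card by (simp add: exp_add)
  then have "\<eta> * ((\<Sum>t<T. x t b) - (\<Sum>t<T. G t)) \<le> ln (card E) + \<eta> * (\<eta> * T * B\<^sup>2)"
    by (simp add: algebra_simps power2_eq_square)
  then show ?thesis using \<eta>(1) by (simp add: field_simps)
qed

section \<open>Number of strategies, range of the gains and tuning of the rate\<close>

text \<open>The bids are determined by the quantities. Padding the quantities with zeros to length
  \<open>m\<close> is injective, as the zeros can be filtered out of a list of positive
  numbers.\<close>

lemma finite_strategies: "finite (strategies v m)"
  and card_strategies_le: "card (strategies v m) \<le> (length v + 1) ^ m"
proof -
  let ?f = "\<lambda>s. map snd s @ replicate (m - length s) 0"
  let ?L = "{qs. set qs \<subseteq> {..length v} \<and> length qs = m}"
  have inj: "inj_on ?f (strategies v m)"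
  proof (rule inj_onI)
    fix s s' assume s: "s \<in> strategies v m" "s' \<in> strategies v m" "?f s = ?f s'"
    have filter: "filter (\<lambda>q. 0 < q) (?f s) = map snd s" if "s \<in> strategies v m" for s
    proof -
      have "\<forall>q\<in>set (map snd s). 0 < q" using strategiesD(4)[OF that] by auto
      then show ?thesis by (simp add: filter_id_conv del: set_map)
    qed
    have snd: "map snd s = map snd s'" using filter[OF s(1)] filter[OF s(2)] s(3) by simp
    then have len: "length s = length s'" by (rule map_eq_imp_length_eq)
    have "cum s l = cum s' l" for l using snd by (simp add: cum_def take_map[symmetric])
    then have "map fst s = map fst s'"
      using strategiesD(6)[OF s(1)] strategiesD(6)[OF s(2)] len by (intro nth_equalityI) auto
    then show "s = s'" using snd by (metis zip_map_fst_snd)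
  qed
  have sub: "?f ` strategies v m \<subseteq> ?L"
  proof (rule image_subsetI)
    fix s assume s: "s \<in> strategies v m"
    have "q \<le> length v" if "q \<in> set (map snd s)" for q
      using member_le_sum_list[OF that] strategiesD(5)[OF s] by (simp add: cum_def)
    then show "?f s \<in> ?L" using strategiesD(2)[OF s] by auto
  qed
  have fin: "finite ?L" by (rule finite_lists_length_eq) simp
  show "finite (strategies v m)" by (rule inj_on_finite[OF inj sub fin])
  have "card (strategies v m) \<le> card ?L" by (rule card_inj_on_le[OF inj sub fin])
  then show "card (strategies v m) \<le> (length v + 1) ^ m"
    by (simp add: card_lists_length_eq)
qed

lemma obtained_value_bounds:
  assumes "valuation v"
  shows "0 \<le> obtained_value v K s b" "obtained_value v K s b \<le> length v"
proof -
  let ?n = "min (length v) (allocation K (bid_vector s) b)"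
  have *: "obtained_value v K s b = (\<Sum>j<?n. v ! j)"
    unfolding obtained_value_def by (subst sum_list_take[symmetric]) (simp_all add: min_def)
  have v: "0 < v ! j \<and> v ! j \<le> 1" if "j < length v" for j
    using assms that by (auto simp: valuation_def)
  show "0 \<le> obtained_value v K s b" unfolding * using v by (intro sum_nonneg) (simp add: less_imp_le)
  have "(\<Sum>j<?n. v ! j) \<le> (\<Sum>j<?n. 1)" using v by (intro sum_mono) simp
  then show "obtained_value v K s b \<le> length v" unfolding * by simp
qed

text \<open>For M = 1 the claimed regret is 0, which is true because there is nothing to
  choose.\<close>

lemma strategies_single_unit:
  assumes "s \<in> strategies v m" "length v = 1"
  shows "s = [(avg v 1, 1)]"
proof -
  note S = strategiesD[OF assms(1)]
  obtain p s' where s: "s = p # s'" using S(1) by (cases s) auto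
  have p: "snd p = 1" "sum_list (map snd s') = 0"
  proof -
    have "0 < snd p" "snd p + sum_list (map snd s') \<le> 1"
      using S(4)[of "fst p" "snd p"] S(5) assms(2) s by (auto simp: cum_def)
    then show "snd p = 1" "sum_list (map snd s') = 0" by linarith+
  qed
  have "s' = []"
    using p(2) S(4)[of "fst (hd s')" "snd (hd s')"] s by (cases s') auto
  moreover have "fst p = avg v 1"
    using S(6)[of 0] s p by (simp add: cum_def)
  ultimately show ?thesis using s p by (simp add: prod_eq_iff)
qed

lemma sqrt_quotient:
  fixes a b :: real
  assumes "0 < a" "0 < b"
  shows "a / sqrt (a / b) = sqrt (a * b)" "b * sqrt (a / b) = sqrt (a * b)"
proof -
  have "sqrt (a / b) * sqrt (a * b) = a"
    using assms by (simp add: real_sqrt_mult[symmetric])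
  then show "a / sqrt (a / b) = sqrt (a * b)"
    using assms by (simp add: divide_eq_eq mult.commute)
  have "sqrt (a * b) = sqrt (b\<^sup>2 * (a / b))" using assms by (simp add: power2_eq_square)
  then show "b * sqrt (a / b) = sqrt (a * b)" using assms unfolding real_sqrt_mult by simp
qed

text \<open>Equates m ln (M + 1) / \<eta> with \<eta> T M^2, where (M + 1)^m bounds the number of
  experts.\<close>

definition learning_rate :: "nat \<Rightarrow> nat \<Rightarrow> nat \<Rightarrow> real" where
  "learning_rate m M T = sqrt (real m * ln (real (M + 1)) / real T) / real M"

lemma learning_rate_pos: "1 \<le> m \<Longrightarrow> 1 \<le> M \<Longrightarrow> 1 \<le> T \<Longrightarrow> 0 < learning_rate m M T"
  by (simp add: learning_rate_def)

text \<open>The constant 4 has two sources: two equal terms of the tuned bound, and a factor 2 for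
  passing from ln (M + 1) to ln M under the root.\<close>

lemma hedge_prob_regret:
  assumes v: "valuation v" and m: "1 \<le> m" and T: "1 \<le> T" and b: "b \<in> strategies v m"
  defines "\<eta> \<equiv> learning_rate m (length v) T"
  shows "(\<Sum>t<T. obtained_value v K b (\<beta> t)) -
      (\<Sum>t<T. \<Sum>e\<in>strategies v m. hedge_prob \<eta> v m K \<beta> t e * obtained_value v K e (\<beta> t))
    \<le> 4 * real (length v) * sqrt (real m * real T * ln (real (length v)))"
proof (cases "length v = 1")
  case True
  have "strategies v m = {b}" using b strategies_single_unit[OF _ True] by blast
  then have "(\<Sum>e\<in>strategies v m. hedge_prob \<eta> v m K \<beta> t e * obtained_value v K e (\<beta> t)) =
      obtained_value v K b (\<beta> t)" for t
    by (simp add: hedge_prob_def)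
  then show ?thesis using True by simp
next
  case False
  let ?E = "strategies v m" and ?M = "real (length v)"
  let ?x = "\<lambda>t e. obtained_value v K e (\<beta> t)"
  let ?L = "real m * ln (?M + 1)"
  let ?R = "(\<Sum>t<T. ?x t b) - (\<Sum>t<T. \<Sum>e\<in>?E. hedge_prob \<eta> v m K \<beta> t e * ?x t e)"
  have "length v \<noteq> 0" using v by (simp add: valuation_def)
  then have M: "2 \<le> ?M" using False by linarith
  have \<eta>: "0 < \<eta>" "\<eta> = sqrt (?L / T) / ?M"
    unfolding \<eta>_def using learning_rate_pos[OF m _ T, of "length v"] M by (auto simp: learning_rate_def add_ac)
  have L: "0 < ?L" using m M by (intro mult_pos_pos ln_gt_zero) auto
  have bound: "?R \<le> 2 * (?M * sqrt (?L * T))"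
  proof (cases "?L \<le> T")
    case True
    \<comment> \<open>\<open>\<eta> * ?M\<close> is the root of \<open>?L / T\<close>, so this case
      is exactly where the general Hedge bound applies.\<close>
    have "\<eta> * ?M \<le> 1" using True M T \<eta>(2) by (simp add: divide_le_eq)
    then have "?R \<le> ln (card ?E) / \<eta> + \<eta> * T * ?M\<^sup>2"
      using hedge_regret[where x = ?x, OF finite_strategies b \<eta>(1), of ?M T] obtained_value_bounds[OF v]
      unfolding hedge_prob_def by simp
    also have "ln (card ?E) \<le> ?L"
    proof -
      have "0 < card ?E" using b finite_strategies by (auto simp: card_gt_0_iff)
      then have "ln (card ?E) \<le> ln (real ((length v + 1) ^ m))"
        using card_strategies_le[of v m] by (intro ln_mono) linarith+
      then show ?thesis by (simp add: ln_realpow add_ac)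
    qed
    then have "ln (card ?E) / \<eta> + \<eta> * T * ?M\<^sup>2 \<le> ?L / \<eta> + \<eta> * T * ?M\<^sup>2"
      using \<eta>(1) by (simp add: divide_right_mono)
    also have "?L / \<eta> = ?M * sqrt (?L * T)"
    proof -
      have "?L / \<eta> = ?M * (?L / sqrt (?L / T))" unfolding \<eta>(2) by simp
      also have "?L / sqrt (?L / T) = sqrt (?L * T)"
        using L T by (intro sqrt_quotient) auto
      finally show ?thesis .
    qed
    also have "\<eta> * T * ?M\<^sup>2 = ?M * sqrt (?L * T)"
    proof -
      have "\<eta> * T * ?M\<^sup>2 = ?M * (T * sqrt (?L / T))"
        unfolding \<eta>(2) using M by (simp add: power2_eq_square)
      also have "T * sqrt (?L / T) = sqrt (?L * T)"
        using L T by (intro sqrt_quotient) auto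
      finally show ?thesis .
    qed
    finally show ?thesis by simp
  next
    case False
    \<comment> \<open>The rate exceeds 1 / M here, but few rounds are played: the trivial bound M T
      is at most M sqrt (L T), as T < L.\<close>
    have "0 \<le> (\<Sum>t<T. \<Sum>e\<in>?E. hedge_prob \<eta> v m K \<beta> t e * ?x t e)"
      unfolding hedge_prob_def using obtained_value_bounds(1)[OF v]
      by (intro sum_nonneg mult_nonneg_nonneg divide_nonneg_nonneg) (auto intro: sum_nonneg)
    then have "?R \<le> (\<Sum>t<T. ?M)"
      using sum_mono[of "{..<T}" "\<lambda>t. ?x t b" "\<lambda>_. ?M"] obtained_value_bounds(2)[OF v] by simp
    also have "\<dots> = ?M * sqrt (real T * T)" by simp
    also have "\<dots> \<le> ?M * sqrt (?L * T)"
      using False by (intro mult_left_mono real_sqrt_le_mono mult_right_mono) auto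
    also have "\<dots> \<le> 2 * (?M * sqrt (?L * T))"
      using L M by simp
    finally show ?thesis .
  qed
  \<comment> \<open>For M \<ge> 2 this gives ln (M + 1) \<le> 2 ln M; the 2 is relaxed to 4 below so
    that its root is an integer.\<close>
  have "?M + 1 \<le> ?M\<^sup>2" using mult_right_mono[OF M, of ?M] M by (simp add: power2_eq_square)
  then have "ln (?M + 1) \<le> ln (?M\<^sup>2)" using M by (intro ln_mono) auto
  also have "ln (?M\<^sup>2) = 2 * ln ?M" using M by (simp add: ln_realpow)
  finally have "?L * T \<le> (real m * (2 * ln ?M)) * T" by (intro mult_right_mono mult_left_mono) auto
  also have "\<dots> \<le> 2\<^sup>2 * (real m * T * ln ?M)" using M by simp
  finally have "sqrt (?L * T) \<le> sqrt (2\<^sup>2 * (real m * T * ln ?M))" by (rule real_sqrt_le_mono)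
  also have "\<dots> = 2 * sqrt (real m * T * ln ?M)" unfolding real_sqrt_mult by simp
  finally have "2 * (?M * sqrt (?L * T)) \<le> 2 * (?M * (2 * sqrt (real m * T * ln ?M)))"
    by (intro mult_left_mono) auto
  then show ?thesis using bound by simp
qed

section \<open>The programs\<close>

text \<open>With \<open>N = M + 2\<close>, the real memory is an array of dimensions \<open>(m + 2) \<times> N \<times> N\<close>.  For \<open>l \<le> m\<close> and
  \<open>z, y \<le> M\<close>, entry \<open>(l, z, y)\<close> holds the transition probability from \<open>z\<close> in layer \<open>l\<close> to \<open>y\<close> in the
  next layer, \<open>(l, z, M + 1)\<close> the potential of \<open>z\<close> in layer \<open>l\<close>, and \<open>(m + 1, z, 0)\<close> the average
  \<open>w_z\<close>.  As there is no multiplication of integers, the multiples of \<open>N\<close> and \<open>N * N\<close> are tabulated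
  in the integer memory, from addresses 10 and \<open>13 + M\<close> on; the cells below 10 are variables.\<close>

definition cell :: "nat \<Rightarrow> nat \<Rightarrow> nat \<Rightarrow> nat \<Rightarrow> nat" where
  "cell M l z y = l * ((M + 2) * (M + 2)) + z * (M + 2) + y"

definition edge_cell :: "nat \<Rightarrow> nat \<Rightarrow> node \<Rightarrow> node \<Rightarrow> nat" where
  "edge_cell m M u x =
    (case u of Sink \<Rightarrow> 0
     | Node l z \<Rightarrow> cell M l z (case x of Sink \<Rightarrow> 0 | Node l' z' \<Rightarrow> z'))"

abbreviation Var :: "nat \<Rightarrow> iexp" where
  "Var k \<equiv> ILoad (IConst k)"

abbreviation Par_M1 :: iexp where
  "Par_M1 \<equiv> IPlus Par_M (IConst 1)"

abbreviation Par_m1 :: iexp where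
  "Par_m1 \<equiv> IPlus Par_m (IConst 1)"

definition address :: "iexp \<Rightarrow> iexp \<Rightarrow> iexp \<Rightarrow> iexp" where
  "address l z y =
    IPlus (IPlus (ILoad (IPlus (IPlus (IConst 13) Par_M) l)) (ILoad (IPlus (IConst 10) z))) y"

abbreviation Get :: "iexp \<Rightarrow> iexp \<Rightarrow> iexp \<Rightarrow> rexp" where
  "Get l z y \<equiv> RLoad (address l z y)"

abbreviation Put :: "iexp \<Rightarrow> iexp \<Rightarrow> iexp \<Rightarrow> rexp \<Rightarrow> com" where
  "Put l z y e \<equiv> RStore (address l z y) e"

abbreviation Avg :: "iexp \<Rightarrow> rexp" where
  "Avg z \<equiv> Get Par_m1 z (IConst 0)"

abbreviation BOr :: "bexp \<Rightarrow> bexp \<Rightarrow> bexp" where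
  "BOr b c \<equiv> BNot (BAnd (BNot b) (BNot c))"

abbreviation IPos :: "iexp \<Rightarrow> bexp" where
  "IPos e \<equiv> ILess (IConst 0) e"

definition sweep_com :: "com \<Rightarrow> com" where
  "sweep_com c = For 0 Par_m1 (For 1 Par_M1 (For 2 Par_M1 c))"

definition push_node_com :: com where
  "push_node_com =
    Seq (Put (Var 0) (Var 1) Par_M1 (RNat (IConst 0)))
      (Seq
        (For 2 Par_M1
          (Put (Var 0) (Var 1) Par_M1
            (RPlus (Get (Var 0) (Var 1) Par_M1)
              (RTimes (Get (Var 0) (Var 1) (Var 2)) (Get (IPlus (Var 0) (IConst 1)) (Var 2) Par_M1)))))
        (For 2 Par_M1
          (Put (Var 0) (Var 1) (Var 2)
            (RDiv
              (RTimes (Get (Var 0) (Var 1) (Var 2)) (Get (IPlus (Var 0) (IConst 1)) (Var 2) Par_M1))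
              (Get (Var 0) (Var 1) Par_M1)))))"

text \<open>Potentials depend on the next layer, so layers are visited from m down to 0; loops only
  count upwards, hence the subtraction.\<close>

definition push_com :: com where
  "push_com =
    For 6 Par_m1 (Seq (IStore (IConst 0) (IMinus Par_m (Var 6))) (For 1 Par_M1 push_node_com))"

text \<open>Both tables arise by repeated addition. The last entry of the first, at address 12 + M,
  is N * N and serves as the increment of the second, which starts in the next cell.\<close>

definition tables_com :: com where
  "tables_com =
    Seq
      (For 0 (IPlus Par_M (IConst 2))
        (IStore (IPlus (IConst 11) (Var 0))
          (IPlus (ILoad (IPlus (IConst 10) (Var 0))) (IPlus Par_M (IConst 2)))))
      (For 0 Par_m1
        (IStore (IPlus (IPlus (IConst 14) Par_M) (Var 0))
          (IPlus (ILoad (IPlus (IPlus (IConst 13) Par_M) (Var 0))) (ILoad (IPlus (IConst 12) Par_M)))))"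

definition averages_com :: com where
  "averages_com =
    For 0 Par_M
      (Put Par_m1 (IPlus (Var 0) (IConst 1)) (IConst 0)
        (RDiv (RPlus (RTimes (Avg (Var 0)) (RNat (Var 0))) (Val (Var 0)))
          (RNat (IPlus (Var 0) (IConst 1)))))"

text \<open>The first disjunct admits y = 0 in every layer but the first, which covers the edges
  into the sink as well as its self-loop.\<close>

definition is_edge :: bexp where
  "is_edge =
    BOr (BAnd (IPos (Var 0)) (BNot (IPos (Var 2))))
      (BAnd (ILess (Var 0) Par_m) (BAnd (ILess (Var 1) (Var 2))
        (BOr (BNot (BOr (IPos (Var 0)) (IPos (Var 1))))
          (BAnd (BAnd (IPos (Var 0)) (IPos (Var 1))) (RLess (Avg (Var 2)) (Avg (Var 1)))))))"

text \<open>The explicit \<open>Put\<close> stores the sink's potential 1 in layer m + 1; the other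
  boundary potentials and w_0 are the zeros of fresh memory.\<close>

definition hedge_init_com :: com where
  "hedge_init_com =
    Seq tables_com (Seq averages_com
      (Seq (Put Par_m1 (IConst 0) Par_M1 (RNat (IConst 1)))
        (Seq (sweep_com (If is_edge (Put (Var 0) (Var 1) (Var 2) (RNat (IConst 1))) Skip))
          push_com)))"

definition rate_exp :: rexp where
  "rate_exp =
    RDiv (RSqrt (RDiv (RTimes (RNat Par_m) (RLn (RNat Par_M1))) (RNat Par_T))) (RNat Par_M)"

text \<open>The exponential of the sum is built as a product, one factor per unit won, so the entry
  serves as its own accumulator. The address of \<open>Bid\<close> is that of threshold number j +
  1.\<close>

definition reweight_com :: com where
  "reweight_com =
    For 3 Par_M
      (If (BAnd (BAnd (BNot (ILess (Var 3) (Var 1))) (ILess (Var 3) (Var 2)))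
            (BNot (RLess (Avg (Var 2)) (Bid (IMinus Par_K (IPlus (Var 3) (IConst 1)))))))
        (Put (Var 0) (Var 1) (Var 2)
          (RTimes (Get (Var 0) (Var 1) (Var 2)) (RExp (RTimes rate_exp (Val (Var 3))))))
        Skip)"

definition hedge_learn_com :: com where
  "hedge_learn_com = Seq (sweep_com reweight_com) push_com"

text \<open>Drawing \<open>y\<close> from the transition probabilities \<open>p_0, ..., p_M\<close> by reservoir sampling: each \<open>y\<close>
  replaces the previous draw with probability \<open>p_y / (p_0 + ... + p_y)\<close>.\<close>

definition draw_com :: com where
  "draw_com =
    For 2 Par_M1
      (Seq
        (Put (IConst 0) (IConst 0) Par_M1
          (RPlus (Get (IConst 0) (IConst 0) Par_M1) (Get (Var 0) (Var 4) (Var 2))))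
        (Flip (RDiv (Get (Var 0) (Var 4) (Var 2)) (Get (IConst 0) (IConst 0) Par_M1))
          (IStore (IConst 5) (Var 2)) Skip))"

text \<open>Cell 4 holds the current and cell 5 the drawn quantity. The loop keeps drawing after
  absorption, where 0 is drawn again and nothing is emitted.\<close>

definition hedge_bid_com :: com where
  "hedge_bid_com =
    Seq (IStore (IConst 4) (IConst 0))
      (For 0 Par_m1
        (Seq (IStore (IConst 5) (IConst 0))
        (Seq (Put (IConst 0) (IConst 0) Par_M1 (RNat (IConst 0)))
        (Seq draw_com
        (Seq (If (IPos (Var 5)) (Emit (Avg (Var 5)) (IMinus (Var 5) (Var 4))) Skip)
          (IStore (IConst 4) (Var 5)))))))"

definition hedge_learner :: learner where
  "hedge_learner = \<lparr>init_com = hedge_init_com, bid_com = hedge_bid_com, learn_com = hedge_learn_com\<rparr>"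

section \<open>Correctness of the programs\<close>

text \<open>An address is a numeral in base M + 2 with unbounded leading digit; division and
  remainder recover the digits.\<close>

lemma cell_inject:
  assumes "z < M + 2" "y < M + 2" "z' < M + 2" "y' < M + 2"
  shows "cell M l z y = cell M l' z' y' \<longleftrightarrow> l = l' \<and> z = z' \<and> y = y'"
proof
  assume eq: "cell M l z y = cell M l' z' y'"
  have decode: "cell M l z y div (M + 2) div (M + 2) = l" "cell M l z y div (M + 2) mod (M + 2) = z"
      "cell M l z y mod (M + 2) = y" if "z < M + 2" "y < M + 2" for l z y
  proof -
    have cell: "cell M l z y = y + (z + l * (M + 2)) * (M + 2)"
      by (simp add: cell_def algebra_simps)
    have "(y + (z + l * N) * N) div N div N = l \<and> (y + (z + l * N) * N) div N mod N = z \<and>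
        (y + (z + l * N) * N) mod N = y" if "z < N" "y < N" for N
      using that by simp
    then show "cell M l z y div (M + 2) div (M + 2) = l" "cell M l z y div (M + 2) mod (M + 2) = z"
        "cell M l z y mod (M + 2) = y"
      unfolding cell using that by blast+
  qed
  show "l = l' \<and> z = z' \<and> y = y'"
    using decode[OF assms(1,2), of l] decode[OF assms(3,4), of l'] unfolding eq by blast
qed simp

lemma cell_less:
  assumes "l \<le> m + 1" "z < M + 2" "y < M + 2"
  shows "cell M l z y < (m + 2) * ((M + 2) * (M + 2))"
proof -
  have "z * (M + 2) + y < (z + 1) * (M + 2)" using assms by simp
  also have "\<dots> \<le> (M + 2) * (M + 2)" using assms by (intro mult_le_mono1) simp
  finally have "cell M l z y < (l + 1) * ((M + 2) * (M + 2))" by (simp add: cell_def)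
  also have "\<dots> \<le> (m + 2) * ((M + 2) * (M + 2))" using assms by (intro mult_le_mono1) simp
  finally show ?thesis .
qed

lemma icell_tick [simp]: "icell (tick n s) = icell s"
  and icell_rset [simp]: "icell (rset a x s) = icell s"
  and icell_emit [simp]: "icell (emit p s) = icell s"
  and out_tick [simp]: "out (tick n s) = out s"
  and out_iset [simp]: "out (iset k j s) = out s"
  and out_rset [simp]: "out (rset a x s) = out s"
  and out_emit [simp]: "out (emit p s) = out s @ [p]"
  by (simp_all add: icell_def tick_def rset_def iset_def emit_def)

lemma nth_default_update:
  "nth_default d (xs[i := x]) j = (if j = i \<and> i < length xs then x else nth_default d xs j)"
  by (auto simp: nth_default_def nth_list_update)

lemma icell_iset: "k < length (imem s) \<Longrightarrow> icell (iset k x s) = (icell s)(k := x)"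
  by (auto simp: icell_def iset_def nth_default_update)

lemma ival_ILoad: "ival (ILoad e) J s = icell s (ival e J s)"
  by (simp add: icell_def)

text \<open>The two bounds on \<open>S\<close> accommodate the real array, and the integer variables
  with both tables, whose last address is 14 + M + m.\<close>

locale auction_machine =
  fixes m K T :: nat and v :: "real list" and S :: nat
  assumes m: "1 \<le> m" and T: "1 \<le> T" and v: "valuation v" and K: "length v \<le> K"
    and S: "(m + 2) * ((length v + 2) * (length v + 2)) \<le> S" "20 + length v + m \<le> S"
begin

abbreviation M :: nat where
  "M \<equiv> length v"

definition inp :: "real list \<Rightarrow> inputs" where
  "inp b = \<lparr>in_m = m, in_K = K, in_T = T, in_vals = v, in_bids = b\<rparr>"

lemma inp_simps [simp]:
  "in_m (inp b) = m" "in_K (inp b) = K" "in_T (inp b) = T" "in_vals (inp b) = v" "in_bids (inp b) = b"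
  by (simp_all add: inp_def)

definition tables :: "state \<Rightarrow> bool" where
  "tables s \<longleftrightarrow> length (imem s) = S \<and> length (rmem s) = S \<and>
    (\<forall>z\<le>M + 2. icell s (10 + z) = z * (M + 2)) \<and>
    (\<forall>l\<le>m + 1. icell s (13 + M + l) = l * ((M + 2) * (M + 2)))"

text \<open>Cut off outside the array, where triples may share addresses; thus a write changes
  \<open>grid\<close> at a single point.\<close>

definition grid :: "state \<Rightarrow> nat \<times> nat \<times> nat \<Rightarrow> real" where
  "grid s = (\<lambda>(l, z, y). if l \<le> m + 1 \<and> z < M + 2 \<and> y < M + 2
     then nth_default 0 (rmem s) (cell M l z y) else 0)"

lemma grid_simps [simp]:
  "grid (tick n s) = grid s" "grid (iset k j s) = grid s" "grid (emit p s) = grid s"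
  by (auto simp: grid_def tick_def iset_def emit_def)

lemma tables_simps [simp]:
  "tables (tick n s) = tables s" "tables (emit p s) = tables s" "tables (rset a x s) = tables s"
  by (simp_all add: tables_def) (simp_all add: tick_def emit_def rset_def)

lemma icell_iset_var [simp]: "tables s \<Longrightarrow> k < 10 \<Longrightarrow> icell (iset k x s) = (icell s)(k := x)"
  using S by (intro icell_iset) (simp add: tables_def)

lemma tables_iset_var [simp]: "tables s \<Longrightarrow> k < 10 \<Longrightarrow> tables (iset k x s)"
  using icell_iset_var[of s k x] unfolding tables_def by (auto simp: iset_def)

lemma grid_rset [simp]:
  assumes "tables s" "l \<le> m + 1" "z \<le> M + 1" "y \<le> M + 1"
  shows "grid (rset (cell M l z y) x s) = (grid s)((l, z, y) := x)"
proof
  fix p :: "nat \<times> nat \<times> nat"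
  obtain l' z' y' where p: "p = (l', z', y')" by (cases p)
  have "cell M l z y < length (rmem s)"
    using cell_less[of l m z M y] assms S by (simp add: tables_def)
  then show "grid (rset (cell M l z y) x s) p = ((grid s)((l, z, y) := x)) p"
    using assms cell_inject[of z' M y' z y l' l] unfolding p
    by (auto simp: grid_def rset_def nth_default_update)
qed

lemma ival_address:
  assumes "tables s" "ival l (inp b) s \<le> m + 1" "ival z (inp b) s \<le> M + 1"
  shows "ival (address l z y) (inp b) s = cell M (ival l (inp b) s) (ival z (inp b) s) (ival y (inp b) s)"
  using assms unfolding address_def tables_def ival.simps(7) ival_ILoad by (simp add: cell_def)

lemma rval_Get [simp]:
  assumes "tables s" "ival l (inp b) s \<le> m + 1" "ival z (inp b) s \<le> M + 1" "ival y (inp b) s \<le> M + 1"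
  shows "rval (Get l z y) (inp b) s = grid s (ival l (inp b) s, ival z (inp b) s, ival y (inp b) s)"
  using assms by (simp add: ival_address grid_def)

lemma wlp_Put [simp]:
  assumes "tables s" "ival l (inp b) s \<le> m + 1" "ival z (inp b) s \<le> M + 1"
  shows "wlp (inp b) (Put l z y e) Q s =
    Q (tick (1 + icost (address l z y) + rcost e)
      (rset (cell M (ival l (inp b) s) (ival z (inp b) s) (ival y (inp b) s)) (rval e (inp b) s) s))"
  using assms by (simp add: wlp_RStore ival_address)

lemma wpe_Put:
  assumes "tables s" "ival l (inp b) s \<le> m + 1" "ival z (inp b) s \<le> M + 1"
  shows "wpe (inp b) (Put l z y e) F s =
    F (tick (1 + icost (address l z y) + rcost e)
      (rset (cell M (ival l (inp b) s) (ival z (inp b) s) (ival y (inp b) s)) (rval e (inp b) s) s))"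
  using assms by (simp add: wpe_RStore ival_address)

declare ival.simps(6) [simp del] rval.simps(2) [simp del]
declare ival_ILoad [simp]

section \<open>Sweeping the array and pushing weights\<close>

text \<open>The body may rely on its own, not yet rewritten entry and on row m + 1, which the sweep
  never writes. It has to preserve the counters of the outer loops; the innermost one is reset in
  each round.\<close>

lemma wlp_sweep:
  assumes "tables s"
    and step: "\<And>s' l z y. l \<le> m \<Longrightarrow> z \<le> M \<Longrightarrow> y \<le> M \<Longrightarrow> tables s' \<Longrightarrow>
      grid s' (l, z, y) = grid s (l, z, y) \<Longrightarrow> (\<And>z y. grid s' (m + 1, z, y) = grid s (m + 1, z, y)) \<Longrightarrow>
      icell s' 0 = l \<Longrightarrow> icell s' 1 = z \<Longrightarrow> icell s' 2 = y \<Longrightarrow>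
      wlp (inp b) c (\<lambda>s''. tables s'' \<and> grid s'' = (grid s')((l, z, y) := f l z y) \<and>
        icell s'' 0 = l \<and> icell s'' 1 = z) s'"
    and final: "\<And>s'. tables s' \<Longrightarrow>
      grid s' = (\<lambda>(l, z, y). if l \<le> m \<and> z \<le> M \<and> y \<le> M then f l z y else grid s (l, z, y)) \<Longrightarrow> Q s'"
  shows "wlp (inp b) (sweep_com c) Q s"
proof -
  define upd where "upd D = (\<lambda>(l, z, y). if (l, z, y) \<in> D then f l z y else grid s (l, z, y))"
    for D :: "(nat \<times> nat \<times> nat) set"
  have upd_insert: "(upd D)((l, z, y) := f l z y) = upd (insert (l, z, y) D)" for D l z y
    by (auto simp: upd_def fun_eq_iff)
  \<comment> \<open>The entries visited before \<open>(l, z, y)\<close> in lexicographic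
    order.\<close>
  let ?D2 = "\<lambda>l z y. {..<l} \<times> {..M} \<times> {..M} \<union> {l} \<times> {..<z} \<times> {..M} \<union> {l} \<times> {z} \<times> {..<y}"
  show ?thesis
    unfolding sweep_com_def
  proof (rule wlp_For[where P = "\<lambda>l s'. tables s' \<and> grid s' = upd ({..<l} \<times> {..M} \<times> {..M})"])
    show "tables (tick (1 + icost Par_m1) s) \<and>
        grid (tick (1 + icost Par_m1) s) = upd ({..<0} \<times> {..M} \<times> {..M})"
      using assms(1) by (auto simp: upd_def)
  next
    fix l s1
    assume l: "l < ival Par_m1 (inp b) s" and s1: "tables s1 \<and> grid s1 = upd ({..<l} \<times> {..M} \<times> {..M})"
    show "wlp (inp b) (For 1 Par_M1 (For 2 Par_M1 c))
        (\<lambda>s'. tables s' \<and> grid s' = upd ({..<Suc l} \<times> {..M} \<times> {..M})) (tick 1 (iset 0 l s1))"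
    proof (rule wlp_For[where P = "\<lambda>z s'. tables s' \<and> grid s' = upd (?D2 l z 0) \<and> icell s' 0 = l"])
      fix z s2
      assume z: "z < ival Par_M1 (inp b) (tick 1 (iset 0 l s1))"
        and s2: "tables s2 \<and> grid s2 = upd (?D2 l z 0) \<and> icell s2 0 = l"
      show "wlp (inp b) (For 2 Par_M1 c) (\<lambda>s'. tables s' \<and> grid s' = upd (?D2 l (Suc z) 0) \<and> icell s' 0 = l)
          (tick 1 (iset 1 z s2))"
      proof (rule wlp_For[where P = "\<lambda>y s'. tables s' \<and> grid s' = upd (?D2 l z y) \<and> icell s' 0 = l \<and> icell s' 1 = z"])
        fix y s3
        assume y: "y < ival Par_M1 (inp b) (tick 1 (iset 1 z s2))"
          and s3: "tables s3 \<and> grid s3 = upd (?D2 l z y) \<and> icell s3 0 = l \<and> icell s3 1 = z"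
        have "insert (l, z, y) (?D2 l z y) = ?D2 l z (Suc y)" by auto
        then have "wlp (inp b) c (\<lambda>s''. tables s'' \<and> grid s'' = (grid (tick 1 (iset 2 y s3)))((l, z, y) := f l z y) \<and>
            icell s'' 0 = l \<and> icell s'' 1 = z) (tick 1 (iset 2 y s3))"
          using l z y s3 by (intro step) (auto simp: upd_def)
        then show "wlp (inp b) c (\<lambda>s'. tables s' \<and> grid s' = upd (?D2 l z (Suc y)) \<and> icell s' 0 = l \<and> icell s' 1 = z)
            (tick 1 (iset 2 y s3))"
          using s3 \<open>insert (l, z, y) (?D2 l z y) = ?D2 l z (Suc y)\<close>
          by (auto simp: upd_insert elim!: wlp_mono)
      next
        fix s' assume "tables s' \<and> grid s' = upd (?D2 l z (ival Par_M1 (inp b) (tick 1 (iset 1 z s2)))) \<and>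
          icell s' 0 = l \<and> icell s' 1 = z"
        moreover have "?D2 l z (M + 1) = ?D2 l (Suc z) 0" by auto
        ultimately show "tables s' \<and> grid s' = upd (?D2 l (Suc z) 0) \<and> icell s' 0 = l" by simp
      qed (use s2 in simp)
    next
      fix s' assume "tables s' \<and> grid s' = upd (?D2 l (ival Par_M1 (inp b) (tick 1 (iset 0 l s1))) 0) \<and> icell s' 0 = l"
      moreover have "?D2 l (M + 1) 0 = {..<Suc l} \<times> {..M} \<times> {..M}" by auto
      ultimately show "tables s' \<and> grid s' = upd ({..<Suc l} \<times> {..M} \<times> {..M})" by simp
    qed (use s1 in simp)
  next
    fix s' assume s': "tables s' \<and> grid s' = upd ({..<ival Par_m1 (inp b) s} \<times> {..M} \<times> {..M})"
    have "upd ({..<ival Par_m1 (inp b) s} \<times> {..M} \<times> {..M}) =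
        (\<lambda>(l, z, y). if l \<le> m \<and> z \<le> M \<and> y \<le> M then f l z y else grid s (l, z, y))"
      by (auto simp: upd_def fun_eq_iff)
    then show "Q s'" using s' by (intro final) auto
  qed
qed


lemma wlp_push_node:
  assumes s: "tables s" "icell s 0 = l" "icell s 1 = z" and l: "l \<le> m" and z: "z \<le> M"
  defines "p \<equiv> \<Sum>y\<le>M. grid s (l, z, y) * grid s (Suc l, y, Suc M)"
  shows "wlp (inp b) push_node_com (\<lambda>s'. tables s' \<and> icell s' 0 = l \<and>
    grid s' = (\<lambda>(l', z', y). if l' = l \<and> z' = z
      then if y \<le> M then grid s (l, z, y) * grid s (Suc l, y, Suc M) / p
        else if y = Suc M then p else grid s (l', z', y)
      else grid s (l', z', y))) s"
  unfolding push_node_com_def wlp_Seq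
proof -
  define r where "r = grid s"
  define f where "f n = (\<Sum>y<n. r (l, z, y) * r (Suc l, y, Suc M))" for n
  have p: "p = f (Suc M)" by (simp add: p_def f_def r_def lessThan_Suc_atMost)
  \<comment> \<open>The row after the first \<open>n\<close> divisions; the potential
    \<open>p\<close> already stands in column M + 1.\<close>
  define h where "h n = (\<lambda>(l', z', y). if l' = l \<and> z' = z
      then if y < n then r (l, z, y) * r (Suc l, y, Suc M) / p
        else if y = Suc M then p else r (l', z', y)
      else r (l', z', y))" for n
  let ?c1 = "For 2 Par_M1
          (Put (Var 0) (Var 1) Par_M1
            (RPlus (Get (Var 0) (Var 1) Par_M1)
              (RTimes (Get (Var 0) (Var 1) (Var 2)) (Get (IPlus (Var 0) (IConst 1)) (Var 2) Par_M1))))"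
  let ?c2 = "For 2 Par_M1
          (Put (Var 0) (Var 1) (Var 2)
            (RDiv
              (RTimes (Get (Var 0) (Var 1) (Var 2)) (Get (IPlus (Var 0) (IConst 1)) (Var 2) Par_M1))
              (Get (Var 0) (Var 1) Par_M1)))"
  let ?Q = "\<lambda>s'. tables s' \<and> icell s' 0 = l \<and> grid s' = h (Suc M)"
  have c2: "wlp (inp b) ?c2 ?Q s'"
    if "tables s'" "icell s' 0 = l" "icell s' 1 = z" "grid s' = r((l, z, Suc M) := p)" for s'
  proof (rule wlp_For[where P = "\<lambda>n s'. tables s' \<and> icell s' 0 = l \<and> icell s' 1 = z \<and> grid s' = h n"])
    fix n s1
    assume n: "n < ival Par_M1 (inp b) s'"
      and s1: "tables s1 \<and> icell s1 0 = l \<and> icell s1 1 = z \<and> grid s1 = h n"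
    have "(h n)((l, z, n) := r (l, z, n) * r (Suc l, n, Suc M) / p) = h (Suc n)"
      using n by (auto simp: h_def fun_eq_iff)
    moreover have "h n (l, z, n) = r (l, z, n)" "h n (Suc l, n, Suc M) = r (Suc l, n, Suc M)"
        "h n (l, z, Suc M) = p"
      using n by (auto simp: h_def)
    ultimately show "wlp (inp b) (Put (Var 0) (Var 1) (Var 2)
            (RDiv
              (RTimes (Get (Var 0) (Var 1) (Var 2)) (Get (IPlus (Var 0) (IConst 1)) (Var 2) Par_M1))
              (Get (Var 0) (Var 1) Par_M1)))
        (\<lambda>s'. tables s' \<and> icell s' 0 = l \<and> icell s' 1 = z \<and> grid s' = h (Suc n)) (tick 1 (iset 2 n s1))"
      using s1 n l z by simp
  qed (use that in \<open>auto simp: h_def fun_eq_iff\<close>)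
  have c1: "wlp (inp b) ?c1 (wlp (inp b) ?c2 ?Q) s'"
    if "tables s'" "icell s' 0 = l" "icell s' 1 = z" "grid s' = r((l, z, Suc M) := 0)" for s'
  proof (rule wlp_For[where P = "\<lambda>n s'. tables s' \<and> icell s' 0 = l \<and> icell s' 1 = z \<and>
      grid s' = r((l, z, Suc M) := f n)"])
    fix n s1
    assume n: "n < ival Par_M1 (inp b) s'"
      and s1: "tables s1 \<and> icell s1 0 = l \<and> icell s1 1 = z \<and> grid s1 = r((l, z, Suc M) := f n)"
    have "f n + r (l, z, n) * r (Suc l, n, Suc M) = f (Suc n)" by (simp add: f_def)
    then show "wlp (inp b) (Put (Var 0) (Var 1) Par_M1
            (RPlus (Get (Var 0) (Var 1) Par_M1)
              (RTimes (Get (Var 0) (Var 1) (Var 2)) (Get (IPlus (Var 0) (IConst 1)) (Var 2) Par_M1))))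
        (\<lambda>s'. tables s' \<and> icell s' 0 = l \<and> icell s' 1 = z \<and> grid s' = r((l, z, Suc M) := f (Suc n)))
        (tick 1 (iset 2 n s1))"
      using s1 n l z by simp
  next
    fix s1
    assume "tables s1 \<and> icell s1 0 = l \<and> icell s1 1 = z \<and>
      grid s1 = r((l, z, Suc M) := f (ival Par_M1 (inp b) s'))"
    then show "wlp (inp b) ?c2 ?Q s1" by (intro c2) (simp_all add: p)
  qed (use that in \<open>simp add: f_def\<close>)
  have "wlp (inp b) (Put (Var 0) (Var 1) Par_M1 (RNat (IConst 0))) (wlp (inp b) ?c1 (wlp (inp b) ?c2 ?Q)) s"
    by (subst wlp_Put; (rule c1)?) (use s l z in \<open>simp_all add: r_def\<close>)
  then show "wlp (inp b) (Put (Var 0) (Var 1) Par_M1 (RNat (IConst 0)))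
      (wlp (inp b) ?c1 (wlp (inp b) ?c2 (\<lambda>s'. tables s' \<and> icell s' 0 = l \<and>
    grid s' = (\<lambda>(l', z', y). if l' = l \<and> z' = z
      then if y \<le> M then grid s (l, z, y) * grid s (Suc l, y, Suc M) / p
        else if y = Suc M then p else grid s (l', z', y)
      else grid s (l', z', y))))) s"
    unfolding h_def r_def less_Suc_eq_le .
qed

text \<open>The invariant between rounds. The potentials of layers up to m are left open, since each
  push recomputes them; this frees entry \<open>(0, 0, Suc M)\<close> as scratch space for the
  sampler.\<close>

definition loaded :: "(node \<Rightarrow> node \<Rightarrow> real) \<Rightarrow> state \<Rightarrow> bool" where
  "loaded g s \<longleftrightarrow> tables s \<and>
    (\<forall>l\<le>m. \<forall>z\<le>M. \<forall>y\<le>M. grid s (l, z, y) = chain_prob v m g l z y) \<and>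
    (\<forall>z\<le>M. grid s (Suc m, z, 0) = avg v z) \<and>
    (\<forall>y\<le>M. grid s (Suc m, y, Suc M) = of_bool (y = 0))"

lemma wlp_push:
  assumes "loaded g s"
  shows "wlp (inp b) push_com (loaded (push_weights v m g)) s"
proof -
  define r where "r = grid s"
  define P where "P l z = potential v m g (layer_node l z)" for l z
  note r = assms[unfolded loaded_def, folded r_def]
  have P: "P l z = (\<Sum>y\<le>M. r (l, z, y) * P (Suc l) y)" if "l \<le> m" "z \<le> M" for l z
    unfolding P_def using r that by (subst potential_layer_node) (auto intro!: sum.cong)
  have P_last: "r (Suc m, y, Suc M) = P (Suc m) y" if "y \<le> M" for y
    using r that unfolding P_def by (simp add: potential_beyond_last_layer)
  \<comment> \<open>Layers from \<open>c\<close> to \<open>m\<close> are finished, and in layer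
    \<open>c - 1\<close> the nodes below \<open>z\<close>.\<close>
  define upd where "upd c z = (\<lambda>(l', z', y).
      if l' \<le> m \<and> z' \<le> M \<and> (c \<le> l' \<or> c = Suc l' \<and> z' < z)
      then if y \<le> M then r (l', z', y) * P (Suc l') y / P l' z'
        else if y = Suc M then P l' z' else r (l', z', y)
      else r (l', z', y))" for c z
  show ?thesis
    unfolding push_com_def
  proof (rule wlp_For[where P = "\<lambda>i s'. tables s' \<and> grid s' = upd (Suc m - i) 0"])
    show "tables (tick (1 + icost Par_m1) s) \<and> grid (tick (1 + icost Par_m1) s) = upd (Suc m - 0) 0"
      using r by (auto simp: upd_def r_def fun_eq_iff)
  next
    fix i s1
    assume i: "i < ival Par_m1 (inp b) s" and s1: "tables s1 \<and> grid s1 = upd (Suc m - i) 0"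
    define l where "l = m - i"
    have l: "l \<le> m" "Suc m - i = Suc l" "Suc m - Suc i = l" using i by (auto simp: l_def)
    have upd_end: "upd (Suc l) (Suc M) = upd l 0"
      by (auto simp: upd_def fun_eq_iff)
    have "wlp (inp b) (For 1 Par_M1 push_node_com) (\<lambda>s'. tables s' \<and> grid s' = upd l 0) s'"
      if "tables s'" "icell s' 0 = l" "grid s' = upd (Suc l) 0" for s'
    proof (rule wlp_For[where P = "\<lambda>z s'. tables s' \<and> icell s' 0 = l \<and> grid s' = upd (Suc l) z"])
      fix z s2
      assume "z < ival Par_M1 (inp b) s'" and s2: "tables s2 \<and> icell s2 0 = l \<and> grid s2 = upd (Suc l) z"
      then have z: "z \<le> M" by simp
      have this_row: "upd (Suc l) z (l, z, y) = r (l, z, y)" for y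
        by (simp add: upd_def)
      \<comment> \<open>Potentials of the next layer were just computed if l < m; for l = m they are
        the stored boundary values.\<close>
      have next_row: "upd (Suc l) z (Suc l, y, Suc M) = P (Suc l) y" if "y \<le> M" for y
        using l that P_last by (auto simp: upd_def le_less_Suc_eq dest: le_neq_implies_less)
      have sum: "(\<Sum>y\<le>M. r (l, z, y) * upd (Suc l) z (Suc l, y, Suc M)) = P l z"
        using P[OF l(1) z] next_row by simp
      have "wlp (inp b) push_node_com (\<lambda>s'. tables s' \<and> icell s' 0 = l \<and>
          grid s' = (\<lambda>(l', z', y). if l' = l \<and> z' = z
            then if y \<le> M then r (l, z, y) * upd (Suc l) z (Suc l, y, Suc M) / P l z
              else if y = Suc M then P l z else upd (Suc l) z (l', z', y)
            else upd (Suc l) z (l', z', y))) (tick 1 (iset 1 z s2))"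
      proof -
        have grid: "grid (tick 1 (iset 1 z s2)) = upd (Suc l) z" using s2 by simp
        show ?thesis
          using s2 l(1) z by (intro wlp_push_node[of "tick 1 (iset 1 z s2)" l z b, unfolded grid this_row sum]) simp_all
      qed
      moreover have "(\<lambda>(l', z', y). if l' = l \<and> z' = z
            then if y \<le> M then r (l, z, y) * upd (Suc l) z (Suc l, y, Suc M) / P l z
              else if y = Suc M then P l z else upd (Suc l) z (l', z', y)
            else upd (Suc l) z (l', z', y)) = upd (Suc l) (Suc z)"
        using next_row l z by (auto simp: fun_eq_iff) (auto simp: upd_def)
      ultimately show "wlp (inp b) push_node_com
          (\<lambda>s'. tables s' \<and> icell s' 0 = l \<and> grid s' = upd (Suc l) (Suc z)) (tick 1 (iset 1 z s2))"
        by simp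
    qed (use that upd_end in auto)
    then show "wlp (inp b) (Seq (IStore (IConst 0) (IMinus Par_m (Var 6))) (For 1 Par_M1 push_node_com))
        (\<lambda>s'. tables s' \<and> grid s' = upd (Suc m - Suc i) 0) (tick 1 (iset 6 i s1))"
      unfolding l using s1 l by (simp add: wlp_Seq wlp_IStore l_def)
  next
    fix s' assume "tables s' \<and> grid s' = upd (Suc m - ival Par_m1 (inp b) s) 0"
    then have s': "tables s'" "grid s' = upd 0 0" by simp_all
    then show "loaded (push_weights v m g) s'"
      using r unfolding loaded_def chain_prob_push_weights P_def[symmetric]
      by (auto simp: upd_def)
  qed
qed

lemma rval_rate_exp [simp]: "rval rate_exp (inp b) s = learning_rate m M T"
  by (simp add: rate_exp_def learning_rate_def)

lemma wlp_learn:
  fixes b :: "real list"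
  assumes s: "loaded g s"
  defines "g' \<equiv> \<lambda>u x. g u x * exp (learning_rate m M T * edge_weight v K b u x)"
  shows "wlp (inp b) hedge_learn_com (loaded (push_weights v m g')) s"
proof -
  let ?\<eta> = "learning_rate m M T"
  define win where "win z y j \<longleftrightarrow> z \<le> j \<and> j < y \<and> threshold K b (Suc j) \<le> avg v y" for z y j
  \<comment> \<open>The entry after units below \<open>n\<close> have been processed; at n = M the
    exponent is the full edge weight.\<close>
  define F where "F l z y n = chain_prob v m g l z y * exp (?\<eta> * (\<Sum>j<n. v ! j * of_bool (win z y j)))"
    for l z y n
  have F_M: "F l z y M = chain_prob v m g' l z y" if "y \<le> M" for l z y
  proof -
    have "(\<Sum>j<M. v ! j * of_bool (win z y j)) =
        (\<Sum>j\<in>{z..<y}. v ! j * of_bool (threshold K b (Suc j) \<le> avg v y))"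
      using that by (intro sum.mono_neutral_cong_right) (auto simp: win_def)
    then show ?thesis by (simp add: F_def g'_def chain_prob_reweight)
  qed
  show ?thesis
    unfolding hedge_learn_com_def wlp_Seq
  proof (rule wlp_sweep[where f = "\<lambda>l z y. F l z y M"])
    show "tables s" using s by (simp add: loaded_def)
  next
    fix s1 l z y
    assume l: "l \<le> m" and z: "z \<le> M" and y: "y \<le> M" and tab: "tables s1"
      and same: "grid s1 (l, z, y) = grid s (l, z, y)" "\<And>z y. grid s1 (m + 1, z, y) = grid s (m + 1, z, y)"
      and cells: "icell s1 0 = l" "icell s1 1 = z" "icell s1 2 = y"
    have g: "grid s1 (l, z, y) = chain_prob v m g l z y" using s l z y same by (simp add: loaded_def)
    have W: "grid s1 (Suc m, y, 0) = avg v y" using s y same(2)[of y 0] by (simp add: loaded_def)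
    show "wlp (inp b) reweight_com (\<lambda>s''. tables s'' \<and> grid s'' = (grid s1)((l, z, y) := F l z y M) \<and>
        icell s'' 0 = l \<and> icell s'' 1 = z) s1"
      unfolding reweight_com_def
    proof (rule wlp_For[where P = "\<lambda>n s'. tables s' \<and> grid s' = (grid s1)((l, z, y) := F l z y n) \<and>
        icell s' 0 = l \<and> icell s' 1 = z \<and> icell s' 2 = y"])
      fix j s2
      assume j: "j < ival Par_M (inp b) s1"
        and s2: "tables s2 \<and> grid s2 = (grid s1)((l, z, y) := F l z y j) \<and>
          icell s2 0 = l \<and> icell s2 1 = z \<and> icell s2 2 = y"
      have F_Suc: "F l z y (Suc j) = (if win z y j then F l z y j * exp (?\<eta> * v ! j) else F l z y j)"
        by (simp add: F_def distrib_left exp_add)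
      have val: "nth_default 0 v j = v ! j" using j by (simp add: nth_default_nth)
      show "wlp (inp b)
        (If (BAnd (BAnd (BNot (ILess (Var 3) (Var 1))) (ILess (Var 3) (Var 2)))
            (BNot (RLess (Avg (Var 2)) (Bid (IMinus Par_K (IPlus (Var 3) (IConst 1)))))))
          (Put (Var 0) (Var 1) (Var 2)
            (RTimes (Get (Var 0) (Var 1) (Var 2)) (RExp (RTimes rate_exp (Val (Var 3))))))
          Skip)
        (\<lambda>s'. tables s' \<and> grid s' = (grid s1)((l, z, y) := F l z y (Suc j)) \<and>
          icell s' 0 = l \<and> icell s' 1 = z \<and> icell s' 2 = y) (tick 1 (iset 3 j s2))"
        using s2 l z y by (simp add: wlp_If wlp_Skip F_Suc win_def W val threshold_def not_less)
    qed (use tab cells g in \<open>auto simp: F_def\<close>)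
  next
    fix s1
    assume "tables s1" "grid s1 = (\<lambda>(l, z, y). if l \<le> m \<and> z \<le> M \<and> y \<le> M then F l z y M else grid s (l, z, y))"
    then have "loaded g' s1" using s by (simp add: loaded_def F_M)
    then show "wlp (inp b) push_com (loaded (push_weights v m g')) s1" by (rule wlp_push)
  qed
qed


section \<open>Initialization: tables, averages and the uniform prior\<close>

lemma rmem_simps [simp]: "rmem (tick n s) = rmem s" "rmem (iset k j s) = rmem s"
  and length_imem_simps [simp]: "length (imem (tick n s)) = length (imem s)"
    "length (imem (iset k j s)) = length (imem s)"
  by (simp_all add: tick_def iset_def)

lemma wlp_tables:
  assumes s: "length (imem s) = S" "rmem s = replicate S 0" "\<And>a. icell s a = 0"
    and Q: "\<And>s'. tables s' \<Longrightarrow> grid s' = (\<lambda>_. 0) \<Longrightarrow> Q s'"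
  shows "wlp (inp b) tables_com Q s"
  unfolding tables_com_def wlp_Seq
\<comment> \<open>The cells above the filled part are tracked as 0 because cell 13 + M, never
  written, is the zeroth entry of the second table.\<close>
proof (rule wlp_For[where P = "\<lambda>i s'. length (imem s') = S \<and> rmem s' = replicate S 0 \<and>
    (\<forall>z\<le>i. icell s' (10 + z) = z * (M + 2)) \<and> (\<forall>a>10 + i. icell s' a = 0)"])
  fix i s1
  assume i: "i < ival (IPlus Par_M (IConst 2)) (inp b) s"
    and s1: "length (imem s1) = S \<and> rmem s1 = replicate S 0 \<and>
      (\<forall>z\<le>i. icell s1 (10 + z) = z * (M + 2)) \<and> (\<forall>a>10 + i. icell s1 a = 0)"
  have "icell s1 (10 + i) = i * (M + 2)" using s1 by blast
  then show "wlp (inp b) (IStore (IPlus (IConst 11) (Var 0))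
          (IPlus (ILoad (IPlus (IConst 10) (Var 0))) (IPlus Par_M (IConst 2))))
      (\<lambda>s'. length (imem s') = S \<and> rmem s' = replicate S 0 \<and>
        (\<forall>z\<le>Suc i. icell s' (10 + z) = z * (M + 2)) \<and> (\<forall>a>10 + Suc i. icell s' a = 0))
      (tick 1 (iset 0 i s1))"
    using s1 i S by (auto simp: wlp_IStore icell_iset le_Suc_eq)
next
  fix s1
  assume s1: "length (imem s1) = S \<and> rmem s1 = replicate S 0 \<and>
      (\<forall>z\<le>ival (IPlus Par_M (IConst 2)) (inp b) s. icell s1 (10 + z) = z * (M + 2)) \<and>
      (\<forall>a>10 + ival (IPlus Par_M (IConst 2)) (inp b) s. icell s1 a = 0)"
  show "wlp (inp b) (For 0 Par_m1
        (IStore (IPlus (IPlus (IConst 14) Par_M) (Var 0))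
          (IPlus (ILoad (IPlus (IPlus (IConst 13) Par_M) (Var 0))) (ILoad (IPlus (IConst 12) Par_M))))) Q s1"
  proof (rule wlp_For[where P = "\<lambda>i s'. length (imem s') = S \<and> rmem s' = replicate S 0 \<and>
    (\<forall>z\<le>M + 2. icell s' (10 + z) = z * (M + 2)) \<and>
    (\<forall>l\<le>i. icell s' (13 + M + l) = l * ((M + 2) * (M + 2)))"])
    show "length (imem (tick (1 + icost Par_m1) s1)) = S \<and> rmem (tick (1 + icost Par_m1) s1) = replicate S 0 \<and>
      (\<forall>z\<le>M + 2. icell (tick (1 + icost Par_m1) s1) (10 + z) = z * (M + 2)) \<and>
      (\<forall>l\<le>0. icell (tick (1 + icost Par_m1) s1) (13 + M + l) = l * ((M + 2) * (M + 2)))"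
      using s1 by simp
  next
    fix i s2
    assume i: "i < ival Par_m1 (inp b) s1"
      and s2: "length (imem s2) = S \<and> rmem s2 = replicate S 0 \<and>
        (\<forall>z\<le>M + 2. icell s2 (10 + z) = z * (M + 2)) \<and>
        (\<forall>l\<le>i. icell s2 (13 + M + l) = l * ((M + 2) * (M + 2)))"
    have "icell s2 (13 + M + i) = i * ((M + 2) * (M + 2))" "icell s2 (10 + (M + 2)) = (M + 2) * (M + 2)"
      using s2 by blast+
    then show "wlp (inp b) (IStore (IPlus (IPlus (IConst 14) Par_M) (Var 0))
          (IPlus (ILoad (IPlus (IPlus (IConst 13) Par_M) (Var 0))) (ILoad (IPlus (IConst 12) Par_M))))
        (\<lambda>s'. length (imem s') = S \<and> rmem s' = replicate S 0 \<and>
          (\<forall>z\<le>M + 2. icell s' (10 + z) = z * (M + 2)) \<and>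
          (\<forall>l\<le>Suc i. icell s' (13 + M + l) = l * ((M + 2) * (M + 2))))
        (tick 1 (iset 0 i s2))"
      using s2 i S(2) by (auto simp: wlp_IStore icell_iset le_Suc_eq)
  next
    fix s' assume "length (imem s') = S \<and> rmem s' = replicate S 0 \<and>
        (\<forall>z\<le>M + 2. icell s' (10 + z) = z * (M + 2)) \<and>
        (\<forall>l\<le>ival Par_m1 (inp b) s1. icell s' (13 + M + l) = l * ((M + 2) * (M + 2)))"
    then show "Q s'" by (intro Q) (auto simp: tables_def grid_def nth_default_def)
  qed
qed (use s in simp)

lemma wlp_averages:
  assumes s: "tables s" "grid s = (\<lambda>_. 0)"
    and Q: "\<And>s'. tables s' \<Longrightarrow>
      grid s' = (\<lambda>(l, z, y). if l = Suc m \<and> y = 0 \<and> z \<le> M then avg v z else 0) \<Longrightarrow> Q s'"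
  shows "wlp (inp b) averages_com Q s"
proof -
  define W where "W n = (\<lambda>(l, z, y). if l = Suc m \<and> y = (0::nat) \<and> z \<le> n then avg v z else 0)" for n
  show ?thesis
    unfolding averages_com_def
  proof (rule wlp_For[where P = "\<lambda>n s'. tables s' \<and> grid s' = W n"])
    \<comment> \<open>\<open>avg v 0\<close> is 0 / 0, that is 0, so the zero memory already
      contains it and the recurrence can start.\<close>
    show "tables (tick (1 + icost Par_M) s) \<and> grid (tick (1 + icost Par_M) s) = W 0"
      using s by (auto simp: W_def avg_def fun_eq_iff)
  next
    fix n s1
    assume n: "n < ival Par_M (inp b) s" and s1: "tables s1 \<and> grid s1 = W n"
    have "(avg v n * n + v ! n) / (n + 1) = avg v (Suc n)"
      using n by (simp add: avg_def take_Suc_conv_app_nth add.commute)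
    then have "(W n)((Suc m, Suc n, 0) := (avg v n * n + v ! n) / (n + 1)) = W (Suc n)"
      by (auto simp: W_def fun_eq_iff le_Suc_eq)
    moreover have "W n (Suc m, n, 0) = avg v n" by (simp add: W_def)
    moreover have "nth_default 0 v n = v ! n" using n by (simp add: nth_default_nth)
    ultimately show "wlp (inp b) (Put Par_m1 (IPlus (Var 0) (IConst 1)) (IConst 0)
        (RDiv (RPlus (RTimes (Avg (Var 0)) (RNat (Var 0))) (Val (Var 0)))
          (RNat (IPlus (Var 0) (IConst 1))))) (\<lambda>s'. tables s' \<and> grid s' = W (Suc n)) (tick 1 (iset 0 n s1))"
      using s1 n by simp
  next
    fix s' assume "tables s' \<and> grid s' = W (ival Par_M (inp b) s)"
    then show "Q s'" by (intro Q) (simp_all add: W_def)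
  qed
qed

lemma bval_is_edge:
  assumes "tables s" "icell s 0 = l" "icell s 1 = z" "icell s 2 = y" "z \<le> M" "y \<le> M" "l \<le> m"
    and "grid s (Suc m, z, 0) = avg v z" "grid s (Suc m, y, 0) = avg v y"
  shows "of_bool (bval is_edge (inp b) s) = chain_prob v m (\<lambda>_ _. 1) l z y"
  using assms by (auto simp: is_edge_def chain_prob_def edge_layer_node)

lemma wlp_init:
  assumes s: "length (imem s) = S" "rmem s = replicate S 0" "\<And>a. icell s a = 0"
  shows "wlp (inp b) hedge_init_com (loaded (push_weights v m (\<lambda>_ _. 1))) s"
  unfolding hedge_init_com_def wlp_Seq
proof (intro wlp_tables s wlp_averages)
  fix s1
  let ?r = "\<lambda>(l, z, y). if l = Suc m \<and> y = 0 \<and> z \<le> M then avg v z else 0"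
  let ?mask = "sweep_com (If is_edge (Put (Var 0) (Var 1) (Var 2) (RNat (IConst 1))) Skip)"
  assume s1: "tables s1" "grid s1 = ?r"
  have mask: "wlp (inp b) ?mask (wlp (inp b) push_com (loaded (push_weights v m (\<lambda>_ _. 1)))) s2"
    if s2: "tables s2" "grid s2 = ?r((Suc m, 0, Suc M) := 1)" for s2
  proof (rule wlp_sweep[where f = "chain_prob v m (\<lambda>_ _. 1)", OF s2(1)])
    fix s3 l z y
    assume l: "l \<le> m" and z: "z \<le> M" and y: "y \<le> M" and tab: "tables s3"
      and same: "grid s3 (l, z, y) = grid s2 (l, z, y)" "\<And>z y. grid s3 (m + 1, z, y) = grid s2 (m + 1, z, y)"
      and cells: "icell s3 0 = l" "icell s3 1 = z" "icell s3 2 = y"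
    have W: "grid s3 (Suc m, z, 0) = avg v z" "grid s3 (Suc m, y, 0) = avg v y"
      using same(2)[of z 0] same(2)[of y 0] s2 z y by simp_all
    \<comment> \<open>Where the test fails nothing is written, so the old content has to be the 0 of
      a non-edge.\<close>
    have zero: "grid s3 (l, z, y) = 0" using same(1) s2 l by simp
    have "chain_prob v m (\<lambda>_ _. 1) l z y = of_bool (bval is_edge (inp b) s3)"
      using bval_is_edge[of s3 l z y b] tab cells z y l W by simp
    then show "wlp (inp b) (If is_edge (Put (Var 0) (Var 1) (Var 2) (RNat (IConst 1))) Skip)
       (\<lambda>s'. tables s' \<and> grid s' = (grid s3)((l, z, y) := chain_prob v m (\<lambda>_ _. 1) l z y) \<and>
         icell s' 0 = l \<and> icell s' 1 = z) s3"
      using tab cells l z y zero by (auto simp: wlp_If wlp_Skip)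
  next
    fix s3
    assume "tables s3" "grid s3 = (\<lambda>(l, z, y). if l \<le> m \<and> z \<le> M \<and> y \<le> M
      then chain_prob v m (\<lambda>_ _. 1) l z y else grid s2 (l, z, y))"
    then have "loaded (\<lambda>_ _. 1) s3" using s2 by (auto simp: loaded_def)
    then show "wlp (inp b) push_com (loaded (push_weights v m (\<lambda>_ _. 1))) s3" by (rule wlp_push)
  qed
  show "wlp (inp b) (Put Par_m1 (IConst 0) Par_M1 (RNat (IConst 1)))
      (wlp (inp b) ?mask (wlp (inp b) push_com (loaded (push_weights v m (\<lambda>_ _. 1))))) s1"
    by (subst wlp_Put; (rule mask)?) (use s1 in simp_all)
qed


section \<open>Sampling a strategy\<close>

lemma loaded_simps [simp]:
  "loaded g (tick n s) = loaded g s" "loaded g (emit p s) = loaded g s"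
  by (simp_all add: loaded_def)

lemma loaded_iset_var [simp]: "loaded g s \<Longrightarrow> k < 10 \<Longrightarrow> loaded g (iset k j s)"
  by (simp add: loaded_def)

lemma loaded_scratch [simp]: "loaded g s \<Longrightarrow> loaded g (rset (cell M 0 0 (Suc M)) x s)"
  by (simp add: loaded_def)

lemma tables_if_loaded: "loaded g s \<Longrightarrow> tables s"
  by (simp add: loaded_def)

text \<open>The second claim needs row sum 1: the sum of the row is the final coefficient of the
  value at the drawn number.\<close>

lemma draw:
  assumes s: "loaded g s" "icell s 0 = l" "icell s 4 = z" "icell s 5 = 0" "grid s (0, 0, Suc M) = 0"
    and l: "l \<le> m" and z: "z \<le> M"
    and nonneg: "\<And>y. 0 \<le> chain_prob v m g l z y"
  shows wlp_draw: "wlp (inp b) draw_com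
      (\<lambda>s'. loaded g s' \<and> tables s' \<and> icell s' 0 = l \<and> icell s' 4 = z \<and> icell s' 5 \<le> M \<and> out s' = out s) s"
    and wpe_draw: "(\<Sum>y\<le>M. chain_prob v m g l z y) = 1 \<Longrightarrow>
      wpe (inp b) draw_com (\<lambda>s'. H (icell s' 5)) s = (\<Sum>y\<le>M. chain_prob v m g l z y * H y)"
proof -
  let ?p = "\<lambda>y. chain_prob v m g l z y"
  let ?P = "\<lambda>n s'. loaded g s' \<and> tables s' \<and> icell s' 0 = l \<and> icell s' 4 = z \<and> icell s' 5 \<le> M \<and> out s' = out s \<and>
    grid s' (0, 0, Suc M) = (\<Sum>y<n. ?p y)"
  let ?c = "Seq
        (Put (IConst 0) (IConst 0) Par_M1
          (RPlus (Get (IConst 0) (IConst 0) Par_M1) (Get (Var 0) (Var 4) (Var 2))))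
        (Flip (RDiv (Get (Var 0) (Var 4) (Var 2)) (Get (IConst 0) (IConst 0) Par_M1))
          (IStore (IConst 5) (Var 2)) Skip)"
  \<comment> \<open>The martingale of reservoir sampling: the current draw carries the mass seen so
    far, every later \<open>y\<close> still its own. At the start the first part has mass 0, at the
    end the second is empty.\<close>
  let ?\<Phi> = "\<lambda>n s'. (\<Sum>y<n. ?p y) * H (icell s' 5) + (\<Sum>y\<in>{n..M}. ?p y * H y)"
  have entry: "grid s' (l, z, y) = ?p y" if "loaded g s'" "y \<le> M" for s' y
    using that l z by (simp add: loaded_def)
  have start: "?P 0 (tick (1 + icost Par_M1) s)"
    using s tables_if_loaded[OF s(1)] by simp
  have step: "wlp (inp b) ?c (?P (Suc n)) (tick 1 (iset 2 n s'))" if "n < ival Par_M1 (inp b) s" "?P n s'" for n s'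
    unfolding wlp_Seq
    by (subst wlp_Put; (rule wlp_Flip)?) (use that l z in \<open>simp_all add: wlp_simps entry\<close>)
  have step_expect: "wpe (inp b) ?c (?\<Phi> (Suc n)) (tick 1 (iset 2 n s')) = ?\<Phi> n s'"
    if n: "n < ival Par_M1 (inp b) s" and s': "?P n s'" for n s'
  proof -
    let ?q = "?p n / ((\<Sum>y<n. ?p y) + ?p n)"
    have sum: "0 \<le> (\<Sum>y<n. ?p y)" using nonneg by (intro sum_nonneg)
    have denom: "0 < (\<Sum>y<n. ?p y) + ?p n \<or> (\<Sum>y<n. ?p y) + ?p n = 0"
      using sum nonneg[of n] by linarith
    have "{n..M} = insert n {Suc n..M}" using n by auto
    then have rest: "(\<Sum>y\<in>{n..M}. ?p y * H y) = ?p n * H n + (\<Sum>y\<in>{Suc n..M}. ?p y * H y)" by simp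
    \<comment> \<open>If the mass seen so far is 0, the quotient is 0 / 0 = 0, and the identity
      persists because the new entry is 0 too.\<close>
    have q: "?q * ((\<Sum>y<n. ?p y) + ?p n) = ?p n"
      using sum nonneg[of n] by (cases "(\<Sum>y<n. ?p y) + ?p n = 0") auto
    have "wpe (inp b) ?c (?\<Phi> (Suc n)) (tick 1 (iset 2 n s')) =
        ?q * (((\<Sum>y<n. ?p y) + ?p n) * H n + (\<Sum>y\<in>{Suc n..M}. ?p y * H y)) +
        (1 - ?q) * (((\<Sum>y<n. ?p y) + ?p n) * H (icell s' 5) + (\<Sum>y\<in>{Suc n..M}. ?p y * H y))"
      unfolding wpe_Seq
      by (subst wpe_Put; (subst wpe_Flip)?)
        (use n s' l z sum nonneg[of n] denom in \<open>simp_all add: wpe_simps entry divide_le_eq_1\<close>)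
    also have "\<dots> = (?q * ((\<Sum>y<n. ?p y) + ?p n)) * H n +
        ((\<Sum>y<n. ?p y) + ?p n - ?q * ((\<Sum>y<n. ?p y) + ?p n)) * H (icell s' 5) +
        (\<Sum>y\<in>{Suc n..M}. ?p y * H y)"
      by (simp only: ring_distribs mult_1_left)
    also have "\<dots> = ?\<Phi> n s'" unfolding q rest by simp
    finally show ?thesis .
  qed
  show "wlp (inp b) draw_com
      (\<lambda>s'. loaded g s' \<and> tables s' \<and> icell s' 0 = l \<and> icell s' 4 = z \<and> icell s' 5 \<le> M \<and> out s' = out s) s"
    unfolding draw_com_def by (rule wlp_For[where P = ?P]) (use start step in blast)+
  assume total: "(\<Sum>y\<le>M. ?p y) = 1"
  have "wpe (inp b) draw_com (?\<Phi> (ival Par_M1 (inp b) s)) s = ?\<Phi> 0 (tick (1 + icost Par_M1) s)"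
    unfolding draw_com_def by (rule wpe_For[where P = ?P]) (use start step step_expect in blast)+
  moreover have "?\<Phi> (ival Par_M1 (inp b) s) = (\<lambda>s'. H (icell s' 5))"
    using total by (simp add: lessThan_Suc_atMost)
  moreover have "?\<Phi> 0 (tick (1 + icost Par_M1) s) = (\<Sum>y\<le>M. ?p y * H y)"
    by (simp add: atLeast0AtMost)
  ultimately show "wpe (inp b) draw_com (\<lambda>s'. H (icell s' 5)) s = (\<Sum>y\<le>M. ?p y * H y)" by simp
qed

text \<open>Both claims share one analysis of the loop body: the martingale is the walk with the
  remaining \<open>Suc m - l\<close> steps, evaluated at the current quantity and the pairs emitted
  so far.\<close>

lemma bid:
  assumes s: "loaded g s"
    and nonneg: "\<And>l z y. 0 \<le> chain_prob v m g l z y"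
    and total: "\<And>l z. l \<le> m \<Longrightarrow> z \<le> M \<Longrightarrow> (l = 0 \<Longrightarrow> z = 0) \<Longrightarrow> (\<Sum>y\<le>M. chain_prob v m g l z y) = 1"
  shows wlp_bid: "wlp (inp b) hedge_bid_com (loaded g) s"
    and wpe_bid: "wpe (inp b) hedge_bid_com (\<lambda>s'. F (out s')) s =
      walk v m (chain_prob v m g) F (Suc m) 0 (out s)"
proof -
  let ?G = "chain_prob v m g"
  let ?P = "\<lambda>l s'. loaded g s' \<and> tables s' \<and> icell s' 4 \<le> M \<and> (l = 0 \<longrightarrow> icell s' 4 = 0)"
  let ?\<Phi> = "\<lambda>l s'. walk v m ?G F (Suc m - l) (icell s' 4) (out s')"
  let ?rest = "Seq (If (IPos (Var 5)) (Emit (Avg (Var 5)) (IMinus (Var 5) (Var 4))) Skip)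
          (IStore (IConst 4) (Var 5))"
  let ?c = "Seq (IStore (IConst 5) (IConst 0))
        (Seq (Put (IConst 0) (IConst 0) Par_M1 (RNat (IConst 0))) (Seq draw_com ?rest))"
  have body: "wlp (inp b) ?c (?P (Suc l)) (tick 1 (iset 0 l s1)) \<and>
      wpe (inp b) ?c (?\<Phi> (Suc l)) (tick 1 (iset 0 l s1)) = ?\<Phi> l s1"
    if l: "l < Suc m" and s1: "?P l s1" for l s1
  proof -
    define z where "z = icell s1 4"
    define s2 where "s2 = tick (1 + icost (IConst 5) + icost (IConst 0)) (iset 5 0 (tick 1 (iset 0 l s1)))"
    define s3 where "s3 = tick (1 + icost (address (IConst 0) (IConst 0) Par_M1) + rcost (RNat (IConst 0)))
      (rset (cell M 0 0 (Suc M)) 0 s2)"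
    have s2: "loaded g s2" "tables s2" using s1 by (simp_all add: s2_def)
    have s3: "loaded g s3" "icell s3 0 = l" "icell s3 4 = z" "icell s3 5 = 0" "grid s3 (0, 0, Suc M) = 0"
        "out s3 = out s1"
      using s1 s2 by (simp_all add: s3_def) (simp_all add: s2_def z_def)
    have lz: "l \<le> m" "z \<le> M" using l s1 by (auto simp: z_def)
    note D = wlp_draw[OF s3(1-5) lz nonneg, of b]
    \<comment> \<open>The continuation value after drawing \<open>y\<close>; what follows the draw
      depends on the random outcome through cell 5 only.\<close>
    define H where "H y = walk v m ?G F (m - l) y
      (if 0 < y then out s1 @ [(avg v y, y - z)] else out s1)" for y
    have avg: "grid s' (Suc m, y, 0) = avg v y" if "loaded g s'" "y \<le> M" for s' y
      using that by (simp add: loaded_def)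
    have "wlp (inp b) ?rest (?P (Suc l)) s'" if "loaded g s' \<and> tables s' \<and> icell s' 5 \<le> M" for s'
      using that by (simp add: wlp_simps)
    then have "wlp (inp b) draw_com (wlp (inp b) ?rest (?P (Suc l))) s3"
      by (intro wlp_mono[OF D]) blast
    then have "wlp (inp b) ?c (?P (Suc l)) (tick 1 (iset 0 l s1))"
      unfolding wlp_Seq wlp_IStore using s2 by (simp add: s2_def s3_def)
    moreover have "wpe (inp b) ?c (?\<Phi> (Suc l)) (tick 1 (iset 0 l s1)) =
        wpe (inp b) draw_com (wpe (inp b) ?rest (?\<Phi> (Suc l))) s3"
      unfolding wpe_Seq wpe_IStore using s2 by (simp add: wpe_Put s2_def s3_def)
    moreover have "\<dots> = wpe (inp b) draw_com (\<lambda>s'. H (icell s' 5)) s3"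
      by (rule wpe_cong[OF D]) (auto simp: wpe_simps H_def avg s3(6))
    moreover have "\<dots> = (\<Sum>y\<le>M. ?G l z y * H y)"
      using s1 lz by (intro wpe_draw s3 nonneg total) (auto simp: z_def)
    moreover have "\<dots> = ?\<Phi> l s1"
    proof -
      have "Suc m - l = Suc (m - l)" "m - (m - l) = l" using lz by auto
      then show ?thesis unfolding H_def z_def by simp
    qed
    ultimately show ?thesis by simp
  qed
  define s0 where "s0 = tick (1 + icost (IConst 4) + icost (IConst 0)) (iset 4 0 s)"
  have s0: "?P 0 s0" "out s0 = out s" "icell s0 4 = 0" using s tables_if_loaded[OF s] by (simp_all add: s0_def)
  have "wlp (inp b) (For 0 Par_m1 ?c) (loaded g) s0"
    by (rule wlp_For[where P = ?P]) (use s0 body in auto)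
  then show "wlp (inp b) hedge_bid_com (loaded g) s"
    unfolding hedge_bid_com_def wlp_Seq wlp_IStore s0_def by simp
  have "wpe (inp b) (For 0 Par_m1 ?c) (?\<Phi> (ival Par_m1 (inp b) s0)) s0 = ?\<Phi> 0 (tick (1 + icost Par_m1) s0)"
    by (rule wpe_For[where P = ?P]) (use s0 body in auto)
  moreover have "?\<Phi> (ival Par_m1 (inp b) s0) = (\<lambda>s'. F (out s'))" by simp
  moreover have "?\<Phi> 0 (tick (1 + icost Par_m1) s0) = walk v m ?G F (Suc m) 0 (out s)"
    using s0 by simp
  ultimately show "wpe (inp b) hedge_bid_com (\<lambda>s'. F (out s')) s = walk v m ?G F (Suc m) 0 (out s)"
    unfolding hedge_bid_com_def wpe_Seq wpe_IStore s0_def by simp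
qed


section \<open>Playing against an oblivious adversary\<close>

abbreviation rate :: real where
  "rate \<equiv> learning_rate m M T"

text \<open>The states are random but the stored probabilities are not: the competing bids are fixed
  in advance and the draws never enter the update.\<close>

lemma loaded_after_rounds:
  "s \<in> set_pmf (after_rounds hedge_learner S m K T v \<beta> t) \<Longrightarrow>
    loaded (edge_prob rate v m K \<beta> t) s"
proof (induction t arbitrary: s)
  case 0
  let ?s = "\<lparr>imem = replicate S 0, rmem = replicate S 0, out = [], steps = 0\<rparr>"
  have "icell ?s a = 0" for a by (simp add: icell_def nth_default_def)
  then show ?case
    using 0 wlp_init[of ?s "[]"] by (simp add: hedge_learner_def wlp_def inp_def)
next
  case (Suc t)
  let ?\<phi> = "edge_prob rate v m K \<beta> t"
  from Suc.prems obtain s1 s2 where s1: "s1 \<in> set_pmf (after_rounds hedge_learner S m K T v \<beta> t)"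
    and s2: "s2 \<in> set_pmf (exec hedge_bid_com (inp []) (start_round s1))"
    and s: "s \<in> set_pmf (exec hedge_learn_com (inp (\<beta> t)) s2)"
    by (auto simp: choice_def hedge_learner_def inp_def)
  have "loaded ?\<phi> (start_round s1)"
    using Suc.IH[OF s1] by (simp add: loaded_def tables_def grid_def start_round_def icell_def)
  then have "wlp (inp []) hedge_bid_com (loaded ?\<phi>) (start_round s1)"
    using v m by (intro wlp_bid chain_prob_nonneg edge_prob_pos sum_chain_prob) (auto simp: valuation_def)
  then have "loaded ?\<phi> s2" using s2 by (simp add: wlp_def)
  then show ?case using wlp_learn[of ?\<phi> s2 "\<beta> t"] s by (simp add: wlp_def)
qed

text \<open>The expectation formula of the sampler is used with two kinds of indicators: of a single
  strategy for the point masses, and of the set of strategies for the support.\<close>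

lemma choice_distribution:
  assumes "loaded (edge_prob rate v m K \<beta> t) s"
  defines "D \<equiv> map_pmf out (choice hedge_learner m K T v s)"
  shows set_choice: "set_pmf D \<subseteq> strategies v m"
    and pmf_choice: "\<And>a. a \<in> strategies v m \<Longrightarrow>
      pmf D a = path_prob (edge_prob rate v m K \<beta> t) (path_of a) \<and>
      path_prob (edge_prob rate v m K \<beta> t) (path_of a) = hedge_prob rate v m K \<beta> t a"
proof -
  let ?\<phi> = "edge_prob rate v m K \<beta> t"
  have start: "loaded ?\<phi> (start_round s)"
    using assms(1) by (simp add: loaded_def tables_def grid_def start_round_def icell_def)
  have nonneg: "0 \<le> chain_prob v m ?\<phi> l z y" for l z y
    by (intro chain_prob_nonneg edge_prob_pos)
  have total: "(\<Sum>y\<le>M. chain_prob v m ?\<phi> l z y) = 1"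
    if "l \<le> m" "z \<le> M" "l = 0 \<Longrightarrow> z = 0" for l z
    using that v m by (intro sum_chain_prob) (auto simp: valuation_def)
  have expect: "expect D F = walk v m (chain_prob v m ?\<phi>) F (Suc m) 0 []" for F
  proof -
    have "expect D F = wpe (inp []) hedge_bid_com (\<lambda>s'. F (out s')) (start_round s)"
      by (simp add: D_def choice_def hedge_learner_def inp_def wpe_def)
    also have "\<dots> = walk v m (chain_prob v m ?\<phi>) F (Suc m) 0 (out (start_round s))"
      by (rule wpe_bid[OF start nonneg total])
    also have "out (start_round s) = []" by (simp add: start_round_def)
    finally show ?thesis .
  qed
  have pmf: "pmf D a = path_prob ?\<phi> (path_of a)" if "a \<in> strategies v m" for a
  proof -
    have "pmf D a = expect D (indicator {a})" by (simp add: pmf.rep_eq)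
    also have "indicator {a} = (\<lambda>s. of_bool (s = a) :: real)" by (auto simp: indicator_def)
    finally show ?thesis using walk_eq_path_prob[OF that, of ?\<phi>] expect by simp
  qed
  have "measure_pmf.prob D (strategies v m) = expect D (indicator (strategies v m))" by simp
  also have "indicator (strategies v m) = (\<lambda>s. of_bool (s \<in> strategies v m) :: real)"
    by (auto simp: indicator_def)
  also have "expect D \<dots> = 1" unfolding expect by (intro walk_in_strategies v m total)
  finally have prob: "measure_pmf.prob D (strategies v m) = 1" .
  then show "set_pmf D \<subseteq> strategies v m"
    by (subst (asm) measure_pmf.prob_eq_1) (auto simp: AE_measure_pmf_iff)
  have "(\<Sum>a\<in>strategies v m. path_prob ?\<phi> (path_of a)) = (\<Sum>a\<in>strategies v m. pmf D a)"
    by (simp add: pmf)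
  also have "\<dots> = 1"
    using prob by (simp add: measure_measure_pmf_finite[OF finite_strategies])
  finally show "pmf D a = path_prob ?\<phi> (path_of a) \<and> path_prob ?\<phi> (path_of a) = hedge_prob rate v m K \<beta> t a"
    if "a \<in> strategies v m" for a
    using pmf path_prob_eq_hedge_prob[OF K] that by blast
qed

lemma loaded_edge_cell:
  assumes "loaded g s" "edge v m u x"
  shows "nth_default 0 (rmem s) (edge_cell m M u x) = g u x"
  using assms(2)
proof (cases rule: edge_cases)
  case (inner l z y)
  then have e: "l < m" "z < y" "y \<le> M" "layer_node l z = u" "layer_node (Suc l) y = x"
    using assms(2) by (auto simp: layer_node_def split: if_splits)
  then have "grid s (l, z, y) = g u x"
    using assms by (simp add: loaded_def chain_prob_def)
  then show ?thesis using inner e by (simp add: grid_def edge_cell_def)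
next
  case (last l z)
  then have e: "l \<le> m" "z \<le> M" "layer_node l z = u" "layer_node (Suc l) 0 = x"
    using assms(2) by (auto simp: layer_node_def)
  then have "grid s (l, z, 0) = g u x"
    using assms by (simp add: loaded_def chain_prob_def)
  then show ?thesis using last e by (simp add: grid_def edge_cell_def)
qed

lemma hedge_learner_weight_pushing:
  "weight_pushing_hedge hedge_learner edge_cell rate S m K T v \<beta>"
proof -
  have "(\<forall>u x. edge v m u x \<longrightarrow> nth_default 0 (rmem s) (edge_cell m M u x) = edge_prob rate v m K \<beta> t u x) \<and>
      out ` set_pmf (choice hedge_learner m K T v s) \<subseteq> strategies v m \<and>
      (\<forall>b\<in>strategies v m. pmf (map_pmf out (choice hedge_learner m K T v s)) b =
        path_prob (edge_prob rate v m K \<beta> t) (path_of b) \<and>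
        path_prob (edge_prob rate v m K \<beta> t) (path_of b) = hedge_prob rate v m K \<beta> t b)"
    if "s \<in> set_pmf (after_rounds hedge_learner S m K T v \<beta> t)" for t s
  proof -
    note L = loaded_after_rounds[OF that]
    show ?thesis using set_choice[OF L] pmf_choice[OF L] loaded_edge_cell[OF L] by simp
  qed
  then show ?thesis unfolding weight_pushing_hedge_def by blast
qed

text \<open>The conditional distribution of the strategy is the same in all reachable states, so
  averaging over them changes nothing.\<close>

lemma expect_submitted:
  "expect (submitted hedge_learner S m K T v \<beta> t) F =
    (\<Sum>a\<in>strategies v m. hedge_prob rate v m K \<beta> t a * F a)"
proof -
  have "expect (map_pmf out (choice hedge_learner m K T v s)) F =
      (\<Sum>a\<in>strategies v m. hedge_prob rate v m K \<beta> t a * F a)"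
    if "s \<in> set_pmf (after_rounds hedge_learner S m K T v \<beta> t)" for s
  proof -
    note L = loaded_after_rounds[OF that]
    have "expect (map_pmf out (choice hedge_learner m K T v s)) F =
        (\<Sum>a\<in>strategies v m. F a * pmf (map_pmf out (choice hedge_learner m K T v s)) a)"
      using set_choice[OF L] by (intro integral_measure_pmf_real finite_strategies) auto
    then show ?thesis using pmf_choice[OF L] by (simp add: mult.commute)
  qed
  moreover have "finite (set_pmf (after_rounds hedge_learner S m K T v \<beta> t))"
    by (induction t) (simp_all add: finite_exec choice_def)
  ultimately show ?thesis
    unfolding submitted_def
    by (subst expect_bind) (auto simp: finite_exec choice_def cong: expect_cong)
qed

lemma hedge_learner_regret:
  "regret hedge_learner S m K T v \<beta> \<le> 4 * real M * sqrt (real m * real T * ln (real M))"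
proof -
  let ?V = "\<lambda>b. \<Sum>t<T. obtained_value v K b (\<beta> t)"
  have "1 \<le> M" using v by (cases v) (auto simp: valuation_def)
  then have "strategies v m \<noteq> {}"
    using singleton_strategy[OF v m, of 1] by blast
  then have "Max (?V ` strategies v m) \<in> ?V ` strategies v m"
    by (intro Max_in) (simp_all add: finite_strategies)
  then obtain b where b: "b \<in> strategies v m" "Max (?V ` strategies v m) = ?V b" by auto
  show ?thesis
    unfolding regret_def b(2) expect_submitted by (rule hedge_prob_regret[OF v m T b(1)])
qed

lemma steps_after_rounds_le:
  assumes B: "m + 2 \<le> B" "M + 2 \<le> B"
    and s: "s \<in> set_pmf (after_rounds hedge_learner S m K T v \<beta> t)"
  shows "steps s \<le> weight hedge_init_com * B ^ nesting hedge_init_com +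
    weight hedge_bid_com * B ^ nesting hedge_bid_com +
    weight hedge_learn_com * B ^ nesting hedge_learn_com"
proof -
  have bounded: "loop_bounded (inp b) B hedge_init_com" "loop_bounded (inp b) B hedge_bid_com"
      "loop_bounded (inp b) B hedge_learn_com" for b
    using B by (simp_all add: hedge_init_com_def tables_com_def averages_com_def sweep_com_def
      push_com_def push_node_com_def hedge_bid_com_def draw_com_def hedge_learn_com_def reweight_com_def)
  have B1: "1 \<le> B" using B by simp
  show ?thesis
  proof (cases t)
    case 0
    then show ?thesis
      using steps_exec_le[OF B1 bounded(1)[of "[]"]] s
      by (fastforce simp: hedge_learner_def inp_def)
  next
    case (Suc t')
    from s obtain s1 s2 where s2: "s2 \<in> set_pmf (exec hedge_bid_com (inp []) (start_round s1))"
      and s3: "s \<in> set_pmf (exec hedge_learn_com (inp (\<beta> t')) s2)"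
      unfolding Suc by (auto simp: choice_def hedge_learner_def inp_def)
    have "steps (start_round s1) = 0" by (simp add: start_round_def)
    then show ?thesis
      using steps_exec_le[OF B1 bounded(2) s2] steps_exec_le[OF B1 bounded(3) s3] by linarith
  qed
qed

end

theorem mainTheorem4:
  shows "\<exists>(A :: learner) (addr :: nat \<Rightarrow> nat \<Rightarrow> node \<Rightarrow> node \<Rightarrow> nat) (\<eta> :: nat \<Rightarrow> nat \<Rightarrow> nat \<Rightarrow> real)
      (c :: nat) (d :: nat) (C :: real).
    \<forall>(m :: nat) (M :: nat) (K :: nat) (T :: nat) (v :: real list) (\<beta> :: nat \<Rightarrow> real list).
      1 \<le> m \<and> 1 \<le> T \<and> valuation v \<and> length v = M \<and> M \<le> K \<and> (\<forall>t<T. \<forall>x\<in>set (\<beta> t). 0 \<le> x) \<longrightarrow>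
      (let S = c * (m + M) ^ d in
         0 < \<eta> m M T \<and>
         weight_pushing_hedge A addr (\<eta> m M T) S m K T v \<beta> \<and>
         (\<forall>t\<le>T. \<forall>s\<in>set_pmf (after_rounds A S m K T v \<beta> t). steps s \<le> c * (m + M) ^ d) \<and>
         regret A S m K T v \<beta> \<le> C * real M * sqrt (real m * real T * ln (real M)))"
proof -
  \<comment> \<open>The 3 is the degree of the real array's size (m + 2)(M + 2)^2; the 20 below pays
    for the integer memory. One polynomial then bounds space and time.\<close>
  define D where "D = nesting hedge_init_com + nesting hedge_bid_com + nesting hedge_learn_com + 3"
  define W where "W = weight hedge_init_com + weight hedge_bid_com + weight hedge_learn_com + 20"
  let ?c = "W * 2 ^ D"
  show ?thesis
  proof (rule exI[of _ hedge_learner], rule exI[of _ edge_cell], rule exI[of _ learning_rate],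
      rule exI[of _ ?c], rule exI[of _ D], rule exI[of _ 4], intro allI impI)
    fix m M K T :: nat and v :: "real list" and \<beta> :: "nat \<Rightarrow> real list"
    assume asm: "1 \<le> m \<and> 1 \<le> T \<and> valuation v \<and> length v = M \<and> M \<le> K \<and>
      (\<forall>t<T. \<forall>x\<in>set (\<beta> t). 0 \<le> x)"
    \<comment> \<open>Since m and M are at least 1, this exceeds both m + 2 and M + 2 or equals
      them; the factor 2 is absorbed by \<open>2 ^ D\<close> in the constant.\<close>
    define B where "B = 2 * (m + M)"
    define S where "S = ?c * (m + M) ^ D"
    have S_eq: "S = W * B ^ D" unfolding S_def B_def power_mult_distrib by (rule mult.assoc)
    have M: "1 \<le> M" using asm by (cases v) (auto simp: valuation_def)
    have B: "m + 2 \<le> B" "M + 2 \<le> B" using asm M by (auto simp: B_def)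
    have pow: "B ^ n \<le> B ^ D" if "n \<le> D" for n using B that by (intro power_increasing) auto
    have "(m + 2) * ((M + 2) * (M + 2)) \<le> B * (B * B)" using B by (intro mult_le_mono)
    also have "\<dots> = 1 * B ^ 3" by (simp add: power3_eq_cube)
    also have "\<dots> \<le> W * B ^ D" by (intro mult_le_mono pow) (auto simp: W_def D_def)
    finally have S1: "(m + 2) * ((M + 2) * (M + 2)) \<le> S" by (simp add: S_eq)
    have "20 + M + m \<le> 20 * B ^ 1" using M asm by (simp add: B_def)
    also have "\<dots> \<le> W * B ^ D" by (intro mult_le_mono pow) (auto simp: W_def D_def)
    finally have S2: "20 + M + m \<le> S" by (simp add: S_eq)
    interpret auction_machine m K T v S
      using asm S1 S2 by unfold_locales auto
    have steps: "steps s \<le> S" if "s \<in> set_pmf (after_rounds hedge_learner S m K T v \<beta> t)" for s t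
    proof -
      have "steps s \<le> weight hedge_init_com * B ^ nesting hedge_init_com +
          weight hedge_bid_com * B ^ nesting hedge_bid_com +
          weight hedge_learn_com * B ^ nesting hedge_learn_com"
        using steps_after_rounds_le[OF _ _ that] B asm by simp
      also have "\<dots> \<le> weight hedge_init_com * B ^ D + weight hedge_bid_com * B ^ D +
          weight hedge_learn_com * B ^ D"
        by (intro add_le_mono mult_le_mono2 pow) (auto simp: D_def)
      also have "\<dots> \<le> S" by (simp add: S_eq W_def add_mult_distrib)
      finally show ?thesis .
    qed
    show "let S = ?c * (m + M) ^ D in
         0 < learning_rate m M T \<and>
         weight_pushing_hedge hedge_learner edge_cell (learning_rate m M T) S m K T v \<beta> \<and>
         (\<forall>t\<le>T. \<forall>s\<in>set_pmf (after_rounds hedge_learner S m K T v \<beta> t). steps s \<le> ?c * (m + M) ^ D) \<and>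
         regret hedge_learner S m K T v \<beta> \<le> 4 * real M * sqrt (real m * real T * ln (real M))"
      unfolding Let_def S_def[symmetric]
      using asm M steps learning_rate_pos[of m M T] hedge_learner_weight_pushing[of \<beta>] hedge_learner_regret[of \<beta>]
      by auto
  qed
qed

end
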